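(* Let $n,m\ge 0$, let $\{\ket{\Phi_b}\}_{b=1}^{2^{n+m}}$ be a stabilizer basis of $\mathcal{H}_n\otimes\mathcal{H}_m$ and let $\ket\psi\in\mathcal{H}_m$ be a stabilizer state, and define the effective POVM $\mu_b=(I\otimes\bra\psi)\ket{\Phi_b}\!\bra{\Phi_b}(I\otimes\ket\psi)$ on $\mathcal{H}_n$. Then $\boldsymbol\mu$ is informationally equivalent to a projective measurement in an orthonormal basis of stabilizer states of $\mathcal{H}_n$: there is an orthonormal stabilizer basis $\{\ket{\Psi_c}\}_{c=1}^{2^n}$ of $\mathcal{H}_n$ with $\operatorname{span}\{\mu_b\}_b=\operatorname{span}\{\ket{\Psi_c}\!\bra{\Psi_c}\}_c$. In particular $s_{\boldsymbol\mu}=2^n$.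
   Context: $\mathcal{H}_n=(\mathbb{C}^2)^{\otimes n}$ is the space of $n$ data qubits and $\mathcal{H}_m=(\mathbb{C}^2)^{\otimes m}$ that of $m$ ancilla qubits. $\mathcal{P}_k$ denotes the $k$-qubit Pauli group (tensor products of $I,X,Y,Z$ with phases $\pm1,\pm i$). A stabilizer group on $k$ qubits is an abelian subgroup of $\mathcal{P}_k$ with $2^k$ elements not containing $-I$; the unique state it stabilizes (fixes with eigenvalue $+1$) is a stabilizer state. A stabilizer basis of $k$ qubits is the orthonormal basis of common eigenvectors of $k$ independent pairwise commuting Pauli operators (i.e. of a maximal abelian subgroup of Pauli operators modulo phases). Such POVMs arise by appending the ancilla state $\ket\psi$ to an input state, applying a Clifford unitary $U$ and measuring in a stabilizer basis $\{\ket{\Phi'_b}\}$, with $\ket{\Phi_b}=U^\dagger\ket{\Phi_b'}$. $s_{\boldsymbol\mu}=\dim\operatorname{span}(\{\mu_b\})$ (complex linear span of operators on $\mathcal{H}_n$). Two POVMs are informationally equivalent when the linear spans of their elements coincide. *)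

theory Defs
  imports "Jordan_Normal_Form.Matrix"
begin

definition kron :: "complex mat \<Rightarrow> complex mat \<Rightarrow> complex mat" where
  "kron A B = mat (dim_row A * dim_row B) (dim_col A * dim_col B)
     (\<lambda>(i,j). A $$ (i div dim_row B, j div dim_col B) * B $$ (i mod dim_row B, j mod dim_col B))"

definition adj :: "complex mat \<Rightarrow> complex mat" where
  "adj A = mat (dim_col A) (dim_row A) (\<lambda>(i,j). cnj (A $$ (j,i)))"

definition ket :: "complex vec \<Rightarrow> complex mat" where
  "ket v = mat (dim_vec v) 1 (\<lambda>(i,j). v $ i)"

definition bra :: "complex vec \<Rightarrow> complex mat" where
  "bra v = mat 1 (dim_vec v) (\<lambda>(i,j). cnj (v $ j))"

definition vinner :: "complex vec \<Rightarrow> complex vec \<Rightarrow> complex" where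
  "vinner v w = (\<Sum>i<dim_vec v. cnj (v $ i) * w $ i)"

definition proj :: "complex vec \<Rightarrow> complex mat" where
  "proj v = ket v * bra v"

definition pauliI :: "complex mat" where "pauliI = mat 2 2 (\<lambda>(i,j). if i = j then 1 else 0)"
definition pauliX :: "complex mat" where "pauliX = mat 2 2 (\<lambda>(i,j). if i \<noteq> j then 1 else 0)"
definition pauliY :: "complex mat" where
  "pauliY = mat 2 2 (\<lambda>(i,j). if i = 0 \<and> j = 1 then - \<i> else if i = 1 \<and> j = 0 then \<i> else 0)"
definition pauliZ :: "complex mat" where
  "pauliZ = mat 2 2 (\<lambda>(i,j). if i = j then (if i = 0 then 1 else -1) else 0)"

definition kron_list :: "complex mat list \<Rightarrow> complex mat" where
  "kron_list Ps = foldr kron Ps (1\<^sub>m 1)"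

definition pauli_strings :: "nat \<Rightarrow> complex mat set" where
  "pauli_strings k = {kron_list Ps | Ps. length Ps = k \<and> set Ps \<subseteq> {pauliI, pauliX, pauliY, pauliZ}}"

definition pauli_group :: "nat \<Rightarrow> complex mat set" where
  "pauli_group k = {c \<cdot>\<^sub>m P | c P. c \<in> {1, -1, \<i>, -\<i>} \<and> P \<in> pauli_strings k}"

definition stabilizer_group :: "nat \<Rightarrow> complex mat set \<Rightarrow> bool" where
  "stabilizer_group k S \<longleftrightarrow>
     S \<subseteq> pauli_group k \<and>
     1\<^sub>m (2^k) \<in> S \<and>
     (\<forall>g\<in>S. \<forall>h\<in>S. g * h \<in> S) \<and>
     (\<forall>g\<in>S. \<exists>h\<in>S. g * h = 1\<^sub>m (2^k)) \<and>
     (\<forall>g\<in>S. \<forall>h\<in>S. g * h = h * g) \<and>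
     card S = 2^k \<and>
     - (1\<^sub>m (2^k)) \<notin> S"

definition stabilizer_state :: "nat \<Rightarrow> complex vec \<Rightarrow> bool" where
  "stabilizer_state k \<psi> \<longleftrightarrow>
     \<psi> \<in> carrier_vec (2^k) \<and> vinner \<psi> \<psi> = 1 \<and>
     (\<exists>S. stabilizer_group k S \<and> (\<forall>g\<in>S. g *\<^sub>v \<psi> = \<psi>))"

definition mat_prod_list :: "nat \<Rightarrow> complex mat list \<Rightarrow> complex mat" where
  "mat_prod_list d As = foldr (*) As (1\<^sub>m d)"

definition orthonormal_basis :: "nat \<Rightarrow> (nat \<Rightarrow> complex vec) \<Rightarrow> bool" where
  "orthonormal_basis d \<Phi> \<longleftrightarrow>
     (\<forall>b<d. \<Phi> b \<in> carrier_vec d) \<and>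
     (\<forall>b<d. \<forall>b'<d. vinner (\<Phi> b) (\<Phi> b') = (if b = b' then 1 else 0))"

text \<open>Stabilizer basis of k qubits: the orthonormal basis (indexed by \<open>b < 2^k\<close>)
  of common eigenvectors of k independent pairwise commuting Pauli operators.
  Independence is taken modulo phases: no nonempty product of generators is a
  scalar multiple of the identity.\<close>
definition stabilizer_basis :: "nat \<Rightarrow> (nat \<Rightarrow> complex vec) \<Rightarrow> bool" where
  "stabilizer_basis k \<Phi> \<longleftrightarrow>
     orthonormal_basis (2^k) \<Phi> \<and>
     (\<exists>g :: nat \<Rightarrow> complex mat.
        (\<forall>i<k. g i \<in> pauli_group k) \<and>
        (\<forall>i<k. \<forall>j<k. g i * g j = g j * g i) \<and>
        (\<forall>T. T \<subseteq> {..<k} \<and> T \<noteq> {} \<longrightarrow>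
            (\<forall>c. mat_prod_list (2^k) (map g (sorted_list_of_set T)) \<noteq> c \<cdot>\<^sub>m 1\<^sub>m (2^k))) \<and>
        (\<forall>b<2^k. \<forall>i<k. \<exists>ev. g i *\<^sub>v \<Phi> b = ev \<cdot>\<^sub>v \<Phi> b))"

definition lin_comb :: "nat \<Rightarrow> complex list \<Rightarrow> complex mat list \<Rightarrow> complex mat" where
  "lin_comb d cs As = foldr (+) (map2 (\<lambda>c A. c \<cdot>\<^sub>m A) cs As) (0\<^sub>m d d)"

definition mspan :: "nat \<Rightarrow> complex mat set \<Rightarrow> complex mat set" where
  "mspan d S = {lin_comb d cs As | cs As. length cs = length As \<and> set As \<subseteq> S}"

definition lin_indep_list :: "nat \<Rightarrow> complex mat list \<Rightarrow> bool" where
  "lin_indep_list d As \<longleftrightarrow>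
     (\<forall>cs. length cs = length As \<and> lin_comb d cs As = 0\<^sub>m d d \<longrightarrow> set cs \<subseteq> {0})"

definition span_dim :: "nat \<Rightarrow> complex mat set \<Rightarrow> nat \<Rightarrow> bool" where
  "span_dim d S r \<longleftrightarrow>
     (\<exists>As. length As = r \<and> set As \<subseteq> carrier_mat d d \<and> lin_indep_list d As \<and>
           mspan d (set As) = mspan d S)"

definition eff_povm :: "nat \<Rightarrow> complex vec \<Rightarrow> complex vec \<Rightarrow> complex mat" where
  "eff_povm n \<psi> \<Phi> = adj (kron (1\<^sub>m (2^n)) (ket \<psi>)) * proj \<Phi> * kron (1\<^sub>m (2^n)) (ket \<psi>)"

end

theory Submission
  imports Defs "Jordan_Normal_Form.Determinant"
begin

text \<open>Put \<open>V = I \<otimes> |\<psi>\<rangle>\<close> and \<open>v\<^sub>b = V\<^sup>\<dagger> \<Phi>\<^sub>b\<close>, so that \<open>\<mu>\<^sub>b = |v\<^sub>b\<rangle>\<langle>v\<^sub>b|\<close> and \<open>\<Sum>\<^sub>b \<mu>\<^sub>b = I\<close>. The projection onto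
  \<open>\<Phi>\<^sub>b\<close> is a linear combination of pairwise commuting Pauli strings \<open>P \<otimes> Q\<close>, and compression by \<open>V\<close> turns
  \<open>P \<otimes> Q\<close> into \<open>\<langle>\<psi>|Q|\<psi>\<rangle> P\<close>. The strings \<open>Q\<close> with nonzero expectation have \<open>\<psi>\<close> as an eigenvector, so they
  commute with each other, and hence so do the corresponding \<open>P\<close>. Thus the \<open>\<mu>\<^sub>b\<close> commute, which for rank-one
  operators means that the \<open>v\<^sub>b\<close> are pairwise parallel or orthogonal; normalising one representative of each
  direction gives an orthonormal basis. The surviving \<open>P\<close> are diagonal in this basis and separate
  its vectors, which yields independent generators.\<close>

subsection \<open>Matrices, sums and Kronecker products\<close>

text \<open>The source of the commutativity is a dichotomy: two Pauli strings commute or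
  anticommute, and these signs multiply over tensor factors. An ancilla string Q that anticommutes
  with some stabilizer of \<psi> has expectation zero, so a nonzero expectation makes Q commute with
  the whole stabilizer group, whose average is the projection onto \<psi>. Two strings with the
  common eigenvector \<psi> cannot anticommute, since their eigenvalues are nonzero; and once the Q
  commute, commuting products of the form P tensor Q force the P to commute.

  The obstacle lies in the conclusion: a stabilizer basis demands \<open>n\<close> generators that
  are independent modulo phases, while compression only delivers an unstructured commuting family,
  possibly with repetitions. Generators are extracted by counting sign patterns instead of by
  symplectic linear algebra over the field with two elements. Effects may vanish or be multiples of
  one another, so representatives must be chosen; the trace of the identity shows that there are
  exactly \<open>2^n\<close> of them.\<close>

lemma index_mult_mat_sum:
  fixes A B :: "complex mat"
  assumes "A \<in> carrier_mat a b" "B \<in> carrier_mat b c" "i < a" "j < c"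
  shows "(A * B) $$ (i,j) = (\<Sum>k<b. A $$ (i,k) * B $$ (k,j))"
  using assms by (auto simp: scalar_prod_def lessThan_atLeast0)

lemma index_mult_mat_vec_sum:
  fixes A :: "complex mat"
  assumes "A \<in> carrier_mat a b" "v \<in> carrier_vec b" "i < a"
  shows "(A *\<^sub>v v) $ i = (\<Sum>k<b. A $$ (i,k) * v $ k)"
  using assms by (auto simp: scalar_prod_def lessThan_atLeast0)

declare index_mult_mat(1) [simp del] index_mult_mat_vec [simp del]

lemma smult_smult_mat [simp]: "(a::complex) \<cdot>\<^sub>m (b \<cdot>\<^sub>m A) = (a * b) \<cdot>\<^sub>m A"
  by (rule eq_matI) auto

lemma one_smult_mat [simp]: "(1::complex) \<cdot>\<^sub>m A = A"
  by (rule eq_matI) auto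

lemma smult_mult_mat_vec:
  fixes A :: "complex mat"
  assumes "A \<in> carrier_mat a b" "v \<in> carrier_vec b"
  shows "(c \<cdot>\<^sub>m A) *\<^sub>v v = c \<cdot>\<^sub>v (A *\<^sub>v v)"
  using assms by (intro eq_vecI) (auto simp: index_mult_mat_vec scalar_prod_def sum_distrib_left mult.assoc)

section \<open>Traces, adjoints, rank-one projections and the inner product\<close>

definition tr :: "complex mat \<Rightarrow> complex" where
  "tr A = (\<Sum>i<dim_row A. A $$ (i,i))"

lemma tr_smult: "A \<in> carrier_mat d d \<Longrightarrow> tr (c \<cdot>\<^sub>m A) = c * tr A"
  by (auto simp: tr_def sum_distrib_left)

lemma tr_one: "tr (1\<^sub>m d) = of_nat d"
  by (simp add: tr_def)

lemma adj_carrier [simp]: "A \<in> carrier_mat a b \<Longrightarrow> adj A \<in> carrier_mat b a"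
  by (auto simp: adj_def)

lemma adj_adj [simp]: "adj (adj A) = A"
  by (rule eq_matI) (auto simp: adj_def)

lemma adj_one [simp]: "adj (1\<^sub>m d) = 1\<^sub>m d"
  by (rule eq_matI) (auto simp: adj_def)

lemma adj_mult:
  assumes "A \<in> carrier_mat a b" "B \<in> carrier_mat b c"
  shows "adj (A * B) = adj B * adj A"
proof (rule eq_matI)
  fix i j assume "i < dim_row (adj B * adj A)" "j < dim_col (adj B * adj A)"
  then have ij: "i < c" "j < a" using assms by (auto simp: adj_def)
  have "adj (A * B) $$ (i,j) = cnj ((A * B) $$ (j,i))"
    using ij assms by (simp add: adj_def)
  also have "\<dots> = (\<Sum>k<b. adj B $$ (i,k) * adj A $$ (k,j))"
    using ij assms by (simp add: index_mult_mat_sum[OF assms] adj_def mult.commute)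
  also have "\<dots> = (adj B * adj A) $$ (i,j)"
    using ij assms by (simp add: index_mult_mat_sum[of _ c b _ a])
  finally show "adj (A * B) $$ (i,j) = (adj B * adj A) $$ (i,j)" .
qed (use assms in \<open>auto simp: adj_def\<close>)

lemma adj_smult: "adj (c \<cdot>\<^sub>m A) = cnj c \<cdot>\<^sub>m adj A"
  by (rule eq_matI) (auto simp: adj_def)

lemma ket_carrier [simp]: "v \<in> carrier_vec d \<Longrightarrow> ket v \<in> carrier_mat d (Suc 0)"
  by (auto simp: ket_def)

lemma bra_eq_adj_ket: "bra v = adj (ket v)"
  by (rule eq_matI) (auto simp: bra_def ket_def adj_def)

lemma bra_carrier [simp]: "v \<in> carrier_vec d \<Longrightarrow> bra v \<in> carrier_mat (Suc 0) d"
  by (auto simp: bra_def)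

lemma mult_ket: "A \<in> carrier_mat a b \<Longrightarrow> v \<in> carrier_vec b \<Longrightarrow> A * ket v = ket (A *\<^sub>v v)"
  by (rule eq_matI) (auto simp: ket_def index_mult_mat(1) index_mult_mat_vec scalar_prod_def)

lemma proj_carrier [simp]: "v \<in> carrier_vec d \<Longrightarrow> proj v \<in> carrier_mat d d"
  by (auto simp: proj_def ket_def bra_def)

lemma proj_index: "v \<in> carrier_vec d \<Longrightarrow> i < d \<Longrightarrow> j < d \<Longrightarrow> proj v $$ (i,j) = v $ i * cnj (v $ j)"
  by (auto simp: proj_def ket_def bra_def index_mult_mat(1) scalar_prod_def)

lemma proj_mult_vec:
  assumes "v \<in> carrier_vec d" "w \<in> carrier_vec d"
  shows "proj v *\<^sub>v w = vinner v w \<cdot>\<^sub>v v"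
proof (rule eq_vecI)
  fix i assume "i < dim_vec (vinner v w \<cdot>\<^sub>v v)"
  then have i: "i < d" using assms by simp
  show "(proj v *\<^sub>v w) $ i = (vinner v w \<cdot>\<^sub>v v) $ i"
    using assms i proj_index[OF assms(1)]
    by (subst index_mult_mat_vec_sum[of _ d d]) (auto simp: vinner_def sum_distrib_left sum_distrib_right ac_simps)
qed (use assms in \<open>auto simp: proj_def ket_def\<close>)

lemma tr_proj: "v \<in> carrier_vec d \<Longrightarrow> tr (proj v) = vinner v v"
  using proj_index[of v d] carrier_matD(1)[OF proj_carrier, of v d] by (simp add: tr_def vinner_def mult.commute)

lemma proj_smult: "proj (c \<cdot>\<^sub>v v) = (c * cnj c) \<cdot>\<^sub>m proj v"
  by (rule eq_matI) (auto simp: proj_def ket_def bra_def index_mult_mat(1) scalar_prod_def)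

text \<open>Compression keeps rank one because \<open>bra v * V\<close> is the adjoint of
  \<open>adj V * ket v\<close>. This is what turns each effect of the POVM into a single
  ket-bra.\<close>

lemma proj_adj_mult_vec:
  assumes "V \<in> carrier_mat a b" "v \<in> carrier_vec a"
  shows "adj V * proj v * V = proj (adj V *\<^sub>v v)"
proof -
  have c: "adj V \<in> carrier_mat b a" "ket v \<in> carrier_mat a 1" "bra v \<in> carrier_mat 1 a"
    using assms by auto
  have "bra v * V = adj (adj V * ket v)"
    by (simp only: adj_mult[OF c(1,2)] bra_eq_adj_ket adj_adj)
  moreover have "adj V * proj v * V = (adj V * ket v) * (bra v * V)"
    using assoc_mult_mat[OF c(1,2,3)] assoc_mult_mat[OF mult_carrier_mat[OF c(1,2)] c(3) assms(1)]
    by (simp only: proj_def)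
  moreover have "adj V * ket v = ket (adj V *\<^sub>v v)"
    by (rule mult_ket[OF c(1) assms(2)])
  ultimately show ?thesis by (simp add: proj_def bra_eq_adj_ket)
qed

lemma vinner_mult_vec:
  assumes "A \<in> carrier_mat a b" "v \<in> carrier_vec a" "w \<in> carrier_vec b"
  shows "vinner v (A *\<^sub>v w) = vinner (adj A *\<^sub>v v) w"
proof -
  have "vinner v (A *\<^sub>v w) = (\<Sum>i<a. \<Sum>k<b. cnj (v $ i) * (A $$ (i,k) * w $ k))"
    using assms by (simp add: vinner_def index_mult_mat_vec_sum[OF assms(1,3)] sum_distrib_left)
  also have "\<dots> = (\<Sum>k<b. \<Sum>i<a. cnj (v $ i) * (A $$ (i,k) * w $ k))"
    by (rule sum.swap)
  also have "\<dots> = (\<Sum>k<b. cnj ((adj A *\<^sub>v v) $ k) * w $ k)"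
    using assms by (intro sum.cong refl, subst index_mult_mat_vec_sum[of _ b a])
      (auto simp: adj_def sum_distrib_left sum_distrib_right ac_simps)
  also have "\<dots> = vinner (adj A *\<^sub>v v) w"
    using assms by (simp add: vinner_def adj_def)
  finally show ?thesis .
qed

lemma vinner_smult_right: "v \<in> carrier_vec d \<Longrightarrow> w \<in> carrier_vec d \<Longrightarrow> vinner v (c \<cdot>\<^sub>v w) = c * vinner v w"
  by (auto simp: vinner_def sum_distrib_left ac_simps)

lemma vinner_smult_left: "v \<in> carrier_vec d \<Longrightarrow> w \<in> carrier_vec d \<Longrightarrow> vinner (c \<cdot>\<^sub>v v) w = cnj c * vinner v w"
  by (auto simp: vinner_def sum_distrib_left ac_simps)

lemma vinner_cnj: "v \<in> carrier_vec d \<Longrightarrow> w \<in> carrier_vec d \<Longrightarrow> vinner w v = cnj (vinner v w)"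
  by (auto simp: vinner_def mult.commute)

lemma vinner_self:
  assumes "v \<in> carrier_vec d"
  shows "vinner v v = of_real (\<Sum>i<d. (cmod (v $ i))\<^sup>2)"
proof -
  have "cnj (v $ i) * v $ i = complex_of_real ((cmod (v $ i))\<^sup>2)" for i
    by (metis complex_norm_square mult.commute)
  then show ?thesis using assms by (simp add: vinner_def)
qed

lemma vinner_self_eq_0:
  assumes "v \<in> carrier_vec d"
  shows "vinner v v = 0 \<longleftrightarrow> v = 0\<^sub>v d"
proof
  assume "vinner v v = 0"
  then have "(\<Sum>i<d. (cmod (v $ i))\<^sup>2) = 0"
    using vinner_self[OF assms] by (metis of_real_eq_0_iff)
  then have "\<forall>i<d. v $ i = 0" by (simp add: sum_nonneg_eq_0_iff)
  then show "v = 0\<^sub>v d" using assms by (intro eq_vecI) auto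
qed (simp add: vinner_def)

text \<open>Matrices of all sizes share one type and have no common zero, so the dimensions are
  parameters; they also fix the shape of an empty sum.\<close>

definition msum :: "nat \<Rightarrow> nat \<Rightarrow> ('a \<Rightarrow> complex mat) \<Rightarrow> 'a set \<Rightarrow> complex mat" where
  "msum a b f I = mat a b (\<lambda>(i,j). \<Sum>t\<in>I. f t $$ (i,j))"

lemma msum_carrier [simp]: "msum a b f I \<in> carrier_mat a b"
  by (simp add: msum_def)

lemma msum_cong: "(\<And>t. t \<in> I \<Longrightarrow> f t = g t) \<Longrightarrow> msum a b f I = msum a b g I"
  by (simp add: msum_def)

lemma mult_msum:
  assumes "X \<in> carrier_mat a b" "\<And>t. t \<in> I \<Longrightarrow> f t \<in> carrier_mat b c"
  shows "X * msum b c f I = msum a c (\<lambda>t. X * f t) I"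
proof (rule eq_matI)
  fix i j assume "i < dim_row (msum a c (\<lambda>t. X * f t) I)" "j < dim_col (msum a c (\<lambda>t. X * f t) I)"
  then have ij: "i < a" "j < c" by (auto simp: msum_def)
  have "(X * msum b c f I) $$ (i,j) = (\<Sum>k<b. X $$ (i,k) * (\<Sum>t\<in>I. f t $$ (k,j)))"
    using ij by (simp add: index_mult_mat_sum[OF assms(1) msum_carrier]) (simp add: msum_def)
  also have "\<dots> = (\<Sum>t\<in>I. \<Sum>k<b. X $$ (i,k) * f t $$ (k,j))"
    by (subst sum.swap) (simp add: sum_distrib_left)
  also have "\<dots> = (\<Sum>t\<in>I. (X * f t) $$ (i,j))"
    by (rule sum.cong) (simp_all add: index_mult_mat_sum[OF assms(1) assms(2)] ij)
  finally show "(X * msum b c f I) $$ (i,j) = msum a c (\<lambda>t. X * f t) I $$ (i,j)"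
    using ij by (simp add: msum_def)
qed (use assms in \<open>auto simp: msum_def\<close>)

lemma msum_mult:
  assumes "X \<in> carrier_mat b c" "\<And>t. t \<in> I \<Longrightarrow> f t \<in> carrier_mat a b"
  shows "msum a b f I * X = msum a c (\<lambda>t. f t * X) I"
proof (rule eq_matI)
  fix i j assume "i < dim_row (msum a c (\<lambda>t. f t * X) I)" "j < dim_col (msum a c (\<lambda>t. f t * X) I)"
  then have ij: "i < a" "j < c" by (auto simp: msum_def)
  have "(msum a b f I * X) $$ (i,j) = (\<Sum>k<b. (\<Sum>t\<in>I. f t $$ (i,k)) * X $$ (k,j))"
    using ij by (simp add: index_mult_mat_sum[OF msum_carrier assms(1)]) (simp add: msum_def)
  also have "\<dots> = (\<Sum>t\<in>I. \<Sum>k<b. f t $$ (i,k) * X $$ (k,j))"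
    by (subst sum.swap) (simp add: sum_distrib_right)
  also have "\<dots> = (\<Sum>t\<in>I. (f t * X) $$ (i,j))"
    by (rule sum.cong) (simp_all add: index_mult_mat_sum[OF assms(2) assms(1)] ij)
  finally show "(msum a b f I * X) $$ (i,j) = msum a c (\<lambda>t. f t * X) I $$ (i,j)"
    using ij by (simp add: msum_def)
qed (use assms in \<open>auto simp: msum_def\<close>)

lemma msum_mult_vec:
  assumes "v \<in> carrier_vec b" "\<And>t. t \<in> I \<Longrightarrow> f t \<in> carrier_mat a b" "\<And>t. t \<in> I \<Longrightarrow> f t *\<^sub>v v = c t \<cdot>\<^sub>v w"
    "w \<in> carrier_vec a"
  shows "msum a b f I *\<^sub>v v = (\<Sum>t\<in>I. c t) \<cdot>\<^sub>v w"
proof (rule eq_vecI)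
  fix i assume "i < dim_vec ((\<Sum>t\<in>I. c t) \<cdot>\<^sub>v w)"
  then have i: "i < a" using assms by simp
  have "(msum a b f I *\<^sub>v v) $ i = (\<Sum>k<b. (\<Sum>t\<in>I. f t $$ (i,k)) * v $ k)"
    using i by (simp add: index_mult_mat_vec_sum[OF msum_carrier assms(1)]) (simp add: msum_def)
  also have "\<dots> = (\<Sum>t\<in>I. \<Sum>k<b. f t $$ (i,k) * v $ k)"
    by (subst sum.swap) (simp add: sum_distrib_right)
  also have "\<dots> = (\<Sum>t\<in>I. (f t *\<^sub>v v) $ i)"
    by (rule sum.cong) (simp_all add: index_mult_mat_vec_sum[OF assms(2) assms(1)] i)
  also have "\<dots> = (\<Sum>t\<in>I. c t * w $ i)"
    using i assms by (intro sum.cong) auto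
  finally show "(msum a b f I *\<^sub>v v) $ i = ((\<Sum>t\<in>I. c t) \<cdot>\<^sub>v w) $ i"
    using i assms by (simp add: sum_distrib_right)
qed (use assms in \<open>auto simp: msum_def\<close>)

lemma tr_msum:
  assumes "\<And>t. t \<in> I \<Longrightarrow> f t \<in> carrier_mat d d"
  shows "tr (msum d d f I) = (\<Sum>t\<in>I. tr (f t))"
proof -
  have "tr (msum d d f I) = (\<Sum>i<d. \<Sum>t\<in>I. f t $$ (i,i))"
    by (simp add: tr_def msum_def)
  also have "\<dots> = (\<Sum>t\<in>I. \<Sum>i<d. f t $$ (i,i))"
    by (rule sum.swap)
  also have "\<dots> = (\<Sum>t\<in>I. tr (f t))"
    using assms by (intro sum.cong) (auto simp: tr_def)
  finally show ?thesis .
qed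

lemma adj_msum:
  assumes "\<And>t. t \<in> I \<Longrightarrow> f t \<in> carrier_mat a b"
  shows "adj (msum a b f I) = msum b a (\<lambda>t. adj (f t)) I"
proof (rule eq_matI)
  fix i j assume "i < dim_row (msum b a (\<lambda>t. adj (f t)) I)" "j < dim_col (msum b a (\<lambda>t. adj (f t)) I)"
  then have ij: "i < b" "j < a" by (auto simp: msum_def)
  have "adj (f t) $$ (i,j) = cnj (f t $$ (j,i))" if "t \<in> I" for t
    using assms[OF that] ij by (auto simp: adj_def)
  then show "adj (msum a b f I) $$ (i,j) = msum b a (\<lambda>t. adj (f t)) I $$ (i,j)"
    using ij by (simp add: msum_def) (simp add: adj_def)
qed (simp_all add: adj_def msum_def)

lemma smult_msum:
  assumes "\<And>t. t \<in> I \<Longrightarrow> f t \<in> carrier_mat a b"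
  shows "c \<cdot>\<^sub>m msum a b f I = msum a b (\<lambda>t. c \<cdot>\<^sub>m f t) I"
proof (rule eq_matI)
  fix i j assume "i < dim_row (msum a b (\<lambda>t. c \<cdot>\<^sub>m f t) I)" "j < dim_col (msum a b (\<lambda>t. c \<cdot>\<^sub>m f t) I)"
  then have ij: "i < a" "j < b" by (auto simp: msum_def)
  have "(c \<cdot>\<^sub>m f t) $$ (i,j) = c * f t $$ (i,j)" if "t \<in> I" for t
    using assms[OF that] ij by auto
  then show "(c \<cdot>\<^sub>m msum a b f I) $$ (i,j) = msum a b (\<lambda>t. c \<cdot>\<^sub>m f t) I $$ (i,j)"
    using ij by (simp add: msum_def sum_distrib_left)
qed (simp_all add: msum_def)

lemma msum_commute:
  assumes "X \<in> carrier_mat d d" "\<And>t. t \<in> I \<Longrightarrow> f t \<in> carrier_mat d d"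
    and "\<And>t. t \<in> I \<Longrightarrow> X * f t = f t * X"
  shows "X * msum d d f I = msum d d f I * X"
  by (simp only: mult_msum[OF assms(1,2)] msum_mult[OF assms(1,2)] assms(3) cong: msum_cong)

section \<open>Kronecker products\<close>

lemma sum_div_mod:
  fixes h :: "nat \<Rightarrow> nat \<Rightarrow> complex"
  shows "(\<Sum>k<b*d. h (k div d) (k mod d)) = (\<Sum>x<b. \<Sum>y<d. h x y)"
proof -
  have "(\<Sum>k<b*d. h (k div d) (k mod d)) = (\<Sum>x<b. \<Sum>k\<in>{x*d..<x*d+d}. h (k div d) (k mod d))"
    by (rule sum.nat_group[symmetric])
  also have "\<dots> = (\<Sum>x<b. \<Sum>y<d. h x y)"
  proof (rule sum.cong[OF refl])
    fix x
    have "(\<Sum>k\<in>{x*d..<x*d+d}. h (k div d) (k mod d)) = (\<Sum>y\<in>{0..<d}. h ((y + x*d) div d) ((y + x*d) mod d))"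
      using sum.shift_bounds_nat_ivl[of "\<lambda>k. h (k div d) (k mod d)" 0 "x*d" d] by (simp add: add.commute)
    also have "\<dots> = (\<Sum>y<d. h x y)"
      by (rule sum.cong) auto
    finally show "(\<Sum>k\<in>{x*d..<x*d+d}. h (k div d) (k mod d)) = (\<Sum>y<d. h x y)" .
  qed
  finally show ?thesis .
qed

lemma kron_carrier [simp]:
  "A \<in> carrier_mat a b \<Longrightarrow> B \<in> carrier_mat c d \<Longrightarrow> kron A B \<in> carrier_mat (a*c) (b*d)"
  by (auto simp: kron_def)

lemma div_mod_less_mult:
  "i < a * c \<Longrightarrow> i div c < a \<and> i mod c < (c::nat)"
  by (cases "c = 0") (auto simp: less_mult_imp_div_less)

text \<open>The inner summation index encodes a pair as quotient and remainder, so the sum over it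
  becomes a double sum, which factors into one matrix product for each tensor factor.\<close>

lemma kron_mult:
  assumes "A \<in> carrier_mat a b" "B \<in> carrier_mat c d" "C \<in> carrier_mat b e" "D \<in> carrier_mat d f"
  shows "kron A B * kron C D = kron (A * C) (B * D)"
proof (rule eq_matI)
  fix i j assume "i < dim_row (kron (A * C) (B * D))" "j < dim_col (kron (A * C) (B * D))"
  then have ij: "i < a * c" "j < e * f" using assms by (auto simp: kron_def)
  have l: "i div c < a" "i mod c < c" "j div f < e" "j mod f < f"
    using div_mod_less_mult ij by auto
  have "(kron A B * kron C D) $$ (i,j) = (\<Sum>k<b*d. kron A B $$ (i,k) * kron C D $$ (k,j))"
    using assms ij by (intro index_mult_mat_sum[of _ "a*c" _ _ "e*f"]) auto
  also have "\<dots> = (\<Sum>k<b*d. (\<lambda>x y. (A $$ (i div c, x) * C $$ (x, j div f)) * (B $$ (i mod c, y) * D $$ (y, j mod f)))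
       (k div d) (k mod d))"
    using assms ij by (intro sum.cong) (auto simp: kron_def)
  also have "\<dots> = (\<Sum>x<b. A $$ (i div c, x) * C $$ (x, j div f)) * (\<Sum>y<d. B $$ (i mod c, y) * D $$ (y, j mod f))"
    by (subst sum_div_mod) (simp add: sum_product)
  also have "\<dots> = kron (A * C) (B * D) $$ (i,j)"
    using assms ij l by (simp add: kron_def index_mult_mat_sum[OF assms(1,3)] index_mult_mat_sum[OF assms(2,4)])
  finally show "(kron A B * kron C D) $$ (i,j) = kron (A * C) (B * D) $$ (i,j)" .
qed (use assms in \<open>auto simp: kron_def\<close>)

lemma kron_assoc:
  assumes "A \<in> carrier_mat a b" "B \<in> carrier_mat c d" "C \<in> carrier_mat e f"
  shows "kron (kron A B) C = kron A (kron B C)"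
proof (rule eq_matI)
  fix i j assume "i < dim_row (kron A (kron B C))" "j < dim_col (kron A (kron B C))"
  then have ij: "i < a * (c * e)" "j < b * (d * f)" using assms by (auto simp: kron_def)
  have l: "i div e < a * c" "i mod (c*e) < c * e" "j div f < b * d" "j mod (d*f) < d * f"
     "j < b * d * f" "i < a * c * e"
    using div_mod_less_mult[of i a "c*e"] div_mod_less_mult[of j b "d*f"]
     div_mod_less_mult[of i "a*c" e] div_mod_less_mult[of j "b*d" f] ij by (auto simp: ac_simps)
  \<comment> \<open>A row or column index has three digits in mixed radix; both bracketings of the
    product read off the same digits.\<close>
  have dm: "i div (c*e) = i div e div c" "j div (d*f) = j div f div d"
    "i mod (c*e) div e = i div e mod c" "j mod (d*f) div f = j div f mod d"
    "i mod (c*e) mod e = i mod e" "j mod (d*f) mod f = j mod f"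
    using div_mod_less_mult[of i "a*c" e] div_mod_less_mult[of j "b*d" f] l
    by (simp_all add: mult.commute[of _ e] mult.commute[of _ f] div_mult2_eq mod_mult2_eq)
  show "kron (kron A B) C $$ (i,j) = kron A (kron B C) $$ (i,j)"
    using assms ij l by (simp add: kron_def dm mult.assoc)
qed (use assms in \<open>auto simp: kron_def\<close>)

lemma kron_adj: "adj (kron A B) = kron (adj A) (adj B)"
proof (rule eq_matI)
  fix i j assume "i < dim_row (kron (adj A) (adj B))" "j < dim_col (kron (adj A) (adj B))"
  then have "i < dim_col A * dim_col B" "j < dim_row A * dim_row B" by (auto simp: kron_def adj_def)
  then show "adj (kron A B) $$ (i,j) = kron (adj A) (adj B) $$ (i,j)"
    by (auto simp: kron_def adj_def div_mod_less_mult)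
qed (auto simp: kron_def adj_def)

lemma tr_kron:
  assumes "A \<in> carrier_mat a a" "B \<in> carrier_mat b b"
  shows "tr (kron A B) = tr A * tr B"
proof -
  have "tr (kron A B) = (\<Sum>k<a*b. (\<lambda>x y. A $$ (x,x) * B $$ (y,y)) (k div b) (k mod b))"
    using assms by (auto simp: tr_def kron_def)
  also have "\<dots> = tr A * tr B"
    using assms by (subst sum_div_mod) (auto simp: sum_product tr_def)
  finally show ?thesis .
qed

lemma kron_smult_left: "kron (c \<cdot>\<^sub>m A) B = c \<cdot>\<^sub>m kron A B"
  by (rule eq_matI) (auto simp: kron_def div_mod_less_mult)

lemma kron_smult_right: "kron A (c \<cdot>\<^sub>m B) = c \<cdot>\<^sub>m kron A B"
  by (rule eq_matI) (auto simp: kron_def div_mod_less_mult)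

lemma kron_one: "kron (1\<^sub>m a) (1\<^sub>m b) = 1\<^sub>m (a * b)"
proof (rule eq_matI)
  fix i j assume "i < dim_row (1\<^sub>m (a * b))" "j < dim_col (1\<^sub>m (a * b))"
  then have "i < a * b" "j < a * b" by auto
  moreover have "i = j \<longleftrightarrow> i div b = j div b \<and> i mod b = j mod b"
    by (metis mult_div_mod_eq)
  ultimately show "kron (1\<^sub>m a) (1\<^sub>m b) $$ (i,j) = 1\<^sub>m (a * b) $$ (i,j)"
    by (auto simp: kron_def div_mod_less_mult)
qed (auto simp: kron_def)

lemma kron_singleton:
  assumes "B \<in> carrier_mat 1 1"
  shows "kron A B = B $$ (0,0) \<cdot>\<^sub>m A"
  using assms by (intro eq_matI) (auto simp: kron_def)

lemma kron_one_left:
  "kron (1\<^sub>m 1) B = B"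
proof (rule eq_matI)
  fix i j assume "i < dim_row B" "j < dim_col B"
  then show "kron (1\<^sub>m 1) B $$ (i,j) = B $$ (i,j)" by (simp add: kron_def)
qed (simp_all add: kron_def)

subsection \<open>Pauli strings\<close>

abbreviation paulis :: "complex mat set" where
  "paulis \<equiv> {pauliI, pauliX, pauliY, pauliZ}"

abbreviation phases :: "complex set" where
  "phases \<equiv> {1, -1, \<i>, -\<i>}"

section \<open>The four single-qubit Pauli matrices\<close>

lemma mat2_eqI:
  assumes "A \<in> carrier_mat 2 2" "B \<in> carrier_mat 2 2"
    and "A $$ (0,0) = B $$ (0,0)" "A $$ (0,1) = B $$ (0,1)" "A $$ (1,0) = B $$ (1,0)" "A $$ (1,1) = B $$ (1,1)"
  shows "A = B"
proof (rule eq_matI)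
  fix i j assume "i < dim_row B" "j < dim_col B"
  then have "i = 0 \<or> i = 1" "j = 0 \<or> j = 1" using assms(2) by auto
  then show "A $$ (i,j) = B $$ (i,j)" using assms by auto
qed (use assms in auto)

lemma mat2_mult_index:
  fixes A B :: "complex mat"
  assumes "A \<in> carrier_mat 2 2" "B \<in> carrier_mat 2 2" "i < 2" "j < 2"
  shows "(A * B) $$ (i,j) = A $$ (i,0) * B $$ (0,j) + A $$ (i,1) * B $$ (1,j)"
  by (simp add: index_mult_mat_sum[OF assms] numeral_2_eq_2)

lemma pauliI_eq_one: "pauliI = 1\<^sub>m 2"
  by (rule eq_matI) (auto simp: pauliI_def)

lemma pauli_carrier: "p \<in> paulis \<Longrightarrow> p \<in> carrier_mat 2 2"
  by (auto simp: pauliI_def pauliX_def pauliY_def pauliZ_def)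

lemma pauli_index:
  "pauliX $$ (0,0) = 0" "pauliX $$ (0,1) = 1" "pauliX $$ (1,0) = 1" "pauliX $$ (1,1) = 0"
  "pauliY $$ (0,0) = 0" "pauliY $$ (0,1) = -\<i>" "pauliY $$ (1,0) = \<i>" "pauliY $$ (1,1) = 0"
  "pauliZ $$ (0,0) = 1" "pauliZ $$ (0,1) = 0" "pauliZ $$ (1,0) = 0" "pauliZ $$ (1,1) = -1"
  by (simp_all add: pauliX_def pauliY_def pauliZ_def)

lemma pauli_products:
  "pauliX * pauliX = 1\<^sub>m 2" "pauliY * pauliY = 1\<^sub>m 2" "pauliZ * pauliZ = 1\<^sub>m 2"
  "pauliX * pauliY = \<i> \<cdot>\<^sub>m pauliZ" "pauliY * pauliX = -\<i> \<cdot>\<^sub>m pauliZ"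
  "pauliY * pauliZ = \<i> \<cdot>\<^sub>m pauliX" "pauliZ * pauliY = -\<i> \<cdot>\<^sub>m pauliX"
  "pauliZ * pauliX = \<i> \<cdot>\<^sub>m pauliY" "pauliX * pauliZ = -\<i> \<cdot>\<^sub>m pauliY"
proof -
  have c: "pauliX \<in> carrier_mat 2 2" "pauliY \<in> carrier_mat 2 2" "pauliZ \<in> carrier_mat 2 2"
    using pauli_carrier by auto
  note [simp] = mat2_mult_index[OF c(1) c(1)] mat2_mult_index[OF c(1) c(2)] mat2_mult_index[OF c(1) c(3)]
    mat2_mult_index[OF c(2) c(1)] mat2_mult_index[OF c(2) c(2)] mat2_mult_index[OF c(2) c(3)]
    mat2_mult_index[OF c(3) c(1)] mat2_mult_index[OF c(3) c(2)] mat2_mult_index[OF c(3) c(3)]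
  note d [simp] = carrier_matD[OF c(1)] carrier_matD[OF c(2)] carrier_matD[OF c(3)]
  show "pauliX * pauliX = 1\<^sub>m 2" "pauliY * pauliY = 1\<^sub>m 2" "pauliZ * pauliZ = 1\<^sub>m 2"
    "pauliX * pauliY = \<i> \<cdot>\<^sub>m pauliZ" "pauliY * pauliX = -\<i> \<cdot>\<^sub>m pauliZ"
    "pauliY * pauliZ = \<i> \<cdot>\<^sub>m pauliX" "pauliZ * pauliY = -\<i> \<cdot>\<^sub>m pauliX"
    "pauliZ * pauliX = \<i> \<cdot>\<^sub>m pauliY" "pauliX * pauliZ = -\<i> \<cdot>\<^sub>m pauliY"
    by (rule mat2_eqI; use c in \<open>simp add: pauli_index[simplified]\<close>)+
qed

lemma pauli_one_mult:
  assumes "p \<in> paulis"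
  shows "1\<^sub>m 2 * p = p" "p * 1\<^sub>m 2 = p"
  using pauli_carrier[OF assms] by auto

lemma pauli_mult_self: "p \<in> paulis \<Longrightarrow> p * p = 1\<^sub>m 2"
  by (elim insertE) (simp_all add: pauliI_eq_one pauli_products)

lemma pauli_mult_closed:
  assumes "p \<in> paulis" "q \<in> paulis"
  shows "\<exists>c\<in>phases. \<exists>r\<in>paulis. p * q = c \<cdot>\<^sub>m r"
proof -
  consider "p = pauliI" | "q = pauliI" | "p = q" | "p \<noteq> q" "p \<noteq> pauliI" "q \<noteq> pauliI" by blast
  then show ?thesis
  proof cases
    case 1
    then have "p * q = 1 \<cdot>\<^sub>m q" using pauli_one_mult[OF assms(2)] by (simp add: pauliI_eq_one)
    with assms show ?thesis by blast
  next
    case 2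
    then have "p * q = 1 \<cdot>\<^sub>m p" using pauli_one_mult[OF assms(1)] by (simp add: pauliI_eq_one)
    with assms show ?thesis by blast
  next
    case 3
    then have "p * q = 1 \<cdot>\<^sub>m pauliI" using pauli_mult_self[OF assms(1)] by (simp add: pauliI_eq_one)
    then show ?thesis by blast
  next
    case 4
    with assms consider "p = pauliX" "q = pauliY" | "p = pauliX" "q = pauliZ" | "p = pauliY" "q = pauliX"
      | "p = pauliY" "q = pauliZ" | "p = pauliZ" "q = pauliX" | "p = pauliZ" "q = pauliY" by blast
    then show ?thesis by cases (use pauli_products(4-9) in blast)+
  qed
qed

text \<open>Distinct non-identity Paulis anticommute; in every other pair one factor is the identity
  or the two coincide, and the sign is 1.\<close>

lemma pauli_commute_sign:
  assumes "p \<in> paulis" "q \<in> paulis"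
  shows "\<exists>s\<in>{1,-1}. p * q = s \<cdot>\<^sub>m (q * p)"
proof -
  consider "p = pauliI" | "q = pauliI" | "p = q" | "p \<noteq> q" "p \<noteq> pauliI" "q \<noteq> pauliI" by blast
  then show ?thesis
  proof cases
    case 1
    then have "p * q = 1 \<cdot>\<^sub>m (q * p)" using pauli_one_mult[OF assms(2)] by (simp add: pauliI_eq_one)
    then show ?thesis by blast
  next
    case 2
    then have "p * q = 1 \<cdot>\<^sub>m (q * p)" using pauli_one_mult[OF assms(1)] by (simp add: pauliI_eq_one)
    then show ?thesis by blast
  next
    case 3
    then have "p * q = 1 \<cdot>\<^sub>m (q * p)" by simp
    then show ?thesis by blast
  next
    case 4
    with assms consider "p = pauliX" "q = pauliY" | "p = pauliX" "q = pauliZ" | "p = pauliY" "q = pauliX"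
      | "p = pauliY" "q = pauliZ" | "p = pauliZ" "q = pauliX" | "p = pauliZ" "q = pauliY" by blast
    then have "p * q = (-1) \<cdot>\<^sub>m (q * p)" by cases (simp_all add: pauli_products)
    then show ?thesis by blast
  qed
qed

lemma pauli_adj: "p \<in> paulis \<Longrightarrow> adj p = p"
proof -
  assume p: "p \<in> paulis"
  note c = pauli_carrier[OF p]
  show ?thesis
    by (rule mat2_eqI, rule adj_carrier[OF c], rule c)
      (use p c in \<open>auto simp: adj_def pauli_index[simplified] pauliI_eq_one\<close>)
qed

lemma pauli_tr: "p \<in> paulis \<Longrightarrow> p = 1\<^sub>m 2 \<or> tr p = 0"
  using carrier_matD(1)[OF pauli_carrier]
  by (elim insertE) (auto simp: pauliI_eq_one tr_def numeral_2_eq_2 pauli_index[simplified])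

section \<open>Pauli strings, by induction on the number of qubits\<close>

lemma pauli_strings_0: "pauli_strings 0 = {1\<^sub>m 1}"
  by (auto simp: pauli_strings_def kron_list_def)

lemma pauli_strings_Suc:
  "pauli_strings (Suc k) = {kron p P | p P. p \<in> paulis \<and> P \<in> pauli_strings k}"
proof (intro equalityI subsetI)
  fix A assume "A \<in> pauli_strings (Suc k)"
  then obtain Ps where Ps: "A = kron_list Ps" "length Ps = Suc k" "set Ps \<subseteq> paulis"
    by (auto simp: pauli_strings_def)
  then obtain p Qs where "Ps = p # Qs" by (cases Ps) auto
  with Ps have "A = kron p (kron_list Qs)" "p \<in> paulis" "kron_list Qs \<in> pauli_strings k"
    by (auto simp: pauli_strings_def kron_list_def)
  then show "A \<in> {kron p P | p P. p \<in> paulis \<and> P \<in> pauli_strings k}" by blast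
next
  fix A assume "A \<in> {kron p P | p P. p \<in> paulis \<and> P \<in> pauli_strings k}"
  then obtain p Qs where Qs: "A = kron p (kron_list Qs)" "p \<in> paulis" "length Qs = k" "set Qs \<subseteq> paulis"
    by (auto simp: pauli_strings_def)
  then have "A = kron_list (p # Qs)" "length (p # Qs) = Suc k" "set (p # Qs) \<subseteq> paulis"
    by (auto simp: kron_list_def)
  then show "A \<in> pauli_strings (Suc k)"
    unfolding pauli_strings_def by blast
qed

lemma pauli_string_SucE:
  assumes "A \<in> pauli_strings (Suc k)"
  obtains p P where "A = kron p P" "p \<in> paulis" "P \<in> pauli_strings k"
  using assms unfolding pauli_strings_Suc by blast

lemma pauli_string_carrier: "P \<in> pauli_strings k \<Longrightarrow> P \<in> carrier_mat (2^k) (2^k)"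
proof (induction k arbitrary: P)
  case 0 then show ?case by (simp add: pauli_strings_0)
next
  case (Suc k)
  from Suc.prems obtain p Q where "P = kron p Q" "p \<in> paulis" "Q \<in> pauli_strings k"
    by (rule pauli_string_SucE)
  then show ?case using kron_carrier[OF pauli_carrier Suc.IH] by auto
qed

lemma one_pauli_string: "1\<^sub>m (2^k) \<in> pauli_strings k"
proof (induction k)
  case (Suc k)
  have "1\<^sub>m (2^Suc k) = kron pauliI (1\<^sub>m (2^k))" by (simp add: pauliI_eq_one kron_one)
  with Suc show ?case unfolding pauli_strings_Suc by blast
qed (simp add: pauli_strings_0)

lemma kron_pauli_mult:
  assumes "p \<in> paulis" "P \<in> pauli_strings k" "q \<in> paulis" "Q \<in> pauli_strings k"
  shows "kron p P * kron q Q = kron (p * q) (P * Q)"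
  by (rule kron_mult[OF pauli_carrier[OF assms(1)] pauli_string_carrier[OF assms(2)]
        pauli_carrier[OF assms(3)] pauli_string_carrier[OF assms(4)]])

lemma pauli_string_mult_self: "P \<in> pauli_strings k \<Longrightarrow> P * P = 1\<^sub>m (2^k)"
proof (induction k arbitrary: P)
  case 0 then show ?case by (simp add: pauli_strings_0)
next
  case (Suc k)
  from Suc.prems obtain p Q where P: "P = kron p Q" "p \<in> paulis" "Q \<in> pauli_strings k"
    by (rule pauli_string_SucE)
  have "P * P = kron (p * p) (Q * Q)"
    unfolding P(1) by (rule kron_pauli_mult[OF P(2,3,2,3)])
  then show ?case using P Suc.IH by (simp add: pauli_mult_self kron_one)
qed

lemma pauli_string_adj: "P \<in> pauli_strings k \<Longrightarrow> adj P = P"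
proof (induction k arbitrary: P)
  case 0 then show ?case by (simp add: pauli_strings_0)
next
  case (Suc k)
  from Suc.prems obtain p Q where P: "P = kron p Q" "p \<in> paulis" "Q \<in> pauli_strings k"
    by (rule pauli_string_SucE)
  then show ?case using Suc.IH by (simp only: kron_adj pauli_adj)
qed

text \<open>The trace is multiplicative over tensor factors, and a single non-identity factor
  already makes it vanish. This is the only orthogonality property of Pauli strings that enters the
  projection formulas.\<close>

lemma pauli_string_tr: "P \<in> pauli_strings k \<Longrightarrow> P = 1\<^sub>m (2^k) \<or> tr P = 0"
proof (induction k arbitrary: P)
  case 0 then show ?case by (simp add: pauli_strings_0)
next
  case (Suc k)
  from Suc.prems obtain p Q where P: "P = kron p Q" "p \<in> paulis" "Q \<in> pauli_strings k"
    by (rule pauli_string_SucE)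
  have t: "tr P = tr p * tr Q"
    unfolding P(1) by (rule tr_kron[OF pauli_carrier[OF P(2)] pauli_string_carrier[OF P(3)]])
  show ?case
  proof (cases "p = 1\<^sub>m 2 \<and> Q = 1\<^sub>m (2^k)")
    case True then show ?thesis by (simp add: P(1) kron_one)
  next
    case False
    then show ?thesis using pauli_tr[OF P(2)] Suc.IH[OF P(3)] t by auto
  qed
qed

lemma pauli_string_mult_closed:
  "P \<in> pauli_strings k \<Longrightarrow> Q \<in> pauli_strings k \<Longrightarrow> \<exists>c\<in>phases. \<exists>R\<in>pauli_strings k. P * Q = c \<cdot>\<^sub>m R"
proof (induction k arbitrary: P Q)
  case 0
  then have "P * Q = 1 \<cdot>\<^sub>m 1\<^sub>m 1" by (simp add: pauli_strings_0)
  then show ?case unfolding pauli_strings_0 by blast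
next
  case (Suc k)
  from Suc.prems(1) obtain p P' where P: "P = kron p P'" "p \<in> paulis" "P' \<in> pauli_strings k"
    by (rule pauli_string_SucE)
  from Suc.prems(2) obtain q Q' where Q: "Q = kron q Q'" "q \<in> paulis" "Q' \<in> pauli_strings k"
    by (rule pauli_string_SucE)
  obtain c r where c: "c \<in> phases" "r \<in> paulis" "p * q = c \<cdot>\<^sub>m r"
    using pauli_mult_closed[OF P(2) Q(2)] by blast
  obtain c' R where c': "c' \<in> phases" "R \<in> pauli_strings k" "P' * Q' = c' \<cdot>\<^sub>m R"
    using Suc.IH[OF P(3) Q(3)] by blast
  have "P * Q = kron (p * q) (P' * Q')"
    unfolding P(1) Q(1) by (rule kron_pauli_mult[OF P(2,3) Q(2,3)])
  also have "\<dots> = (c' * c) \<cdot>\<^sub>m kron r R"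
    by (simp only: c c' kron_smult_left kron_smult_right smult_smult_mat)
  finally have "P * Q = (c' * c) \<cdot>\<^sub>m kron r R" .
  moreover have "c' * c \<in> phases" using c(1) c'(1) by auto
  moreover have "kron r R \<in> pauli_strings (Suc k)" using c(2) c'(2) unfolding pauli_strings_Suc by blast
  ultimately show ?case by blast
qed

text \<open>Every tensor factor contributes a sign, and the signs multiply.\<close>

lemma pauli_string_commute_sign:
  "P \<in> pauli_strings k \<Longrightarrow> Q \<in> pauli_strings k \<Longrightarrow> \<exists>s\<in>{1,-1}. P * Q = s \<cdot>\<^sub>m (Q * P)"
proof (induction k arbitrary: P Q)
  case 0
  then have "P * Q = 1 \<cdot>\<^sub>m (Q * P)" by (simp add: pauli_strings_0)
  then show ?case by blast
next
  case (Suc k)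
  from Suc.prems(1) obtain p P' where P: "P = kron p P'" "p \<in> paulis" "P' \<in> pauli_strings k"
    by (rule pauli_string_SucE)
  from Suc.prems(2) obtain q Q' where Q: "Q = kron q Q'" "q \<in> paulis" "Q' \<in> pauli_strings k"
    by (rule pauli_string_SucE)
  obtain c where c: "c \<in> {1,-1}" "p * q = c \<cdot>\<^sub>m (q * p)"
    using pauli_commute_sign[OF P(2) Q(2)] by blast
  obtain c' where c': "c' \<in> {1,-1}" "P' * Q' = c' \<cdot>\<^sub>m (Q' * P')"
    using Suc.IH[OF P(3) Q(3)] by blast
  have "P * Q = kron (p * q) (P' * Q')"
    unfolding P(1) Q(1) by (rule kron_pauli_mult[OF P(2,3) Q(2,3)])
  also have "\<dots> = (c' * c) \<cdot>\<^sub>m kron (q * p) (Q' * P')"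
    by (simp only: c(2) c'(2) kron_smult_left kron_smult_right smult_smult_mat)
  also have "kron (q * p) (Q' * P') = Q * P"
    unfolding P(1) Q(1) by (rule kron_pauli_mult[OF Q(2,3) P(2,3), symmetric])
  finally have "P * Q = (c' * c) \<cdot>\<^sub>m (Q * P)" .
  moreover have "c' * c \<in> {1,-1}" using c(1) c'(1) by auto
  ultimately show ?case by blast
qed

text \<open>Separates the data qubits from the ancilla qubits: the leading \<open>k\<close> factors
  are peeled off one at a time and regrouped by associativity of \<open>kron\<close>.\<close>

lemma pauli_string_split:
  "P \<in> pauli_strings (k + l) \<Longrightarrow> \<exists>A\<in>pauli_strings k. \<exists>B\<in>pauli_strings l. P = kron A B"
proof (induction k arbitrary: P)
  case 0
  have "P = kron (1\<^sub>m 1) P" by (rule kron_one_left[symmetric])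
  with 0 show ?case unfolding pauli_strings_0 by (metis add_0 singletonI)
next
  case (Suc k)
  then obtain p Q where P: "P = kron p Q" "p \<in> paulis" "Q \<in> pauli_strings (k + l)"
    using pauli_string_SucE[of P "k + l"] by auto
  obtain A B where AB: "A \<in> pauli_strings k" "B \<in> pauli_strings l" "Q = kron A B"
    using Suc.IH[OF P(3)] by blast
  have "P = kron (kron p A) B"
    unfolding P(1) AB(3)
    by (rule kron_assoc[OF pauli_carrier[OF P(2)] pauli_string_carrier[OF AB(1)] pauli_string_carrier[OF AB(2)], symmetric])
  moreover have "kron p A \<in> pauli_strings (Suc k)" using P(2) AB(1) unfolding pauli_strings_Suc by blast
  ultimately show ?case using AB(2) by blast
qed

section \<open>The Pauli group with phases\<close>

lemma pauli_groupE:
  assumes "g \<in> pauli_group k"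
  obtains c P where "c \<in> phases" "P \<in> pauli_strings k" "g = c \<cdot>\<^sub>m P"
  using assms unfolding pauli_group_def by blast

lemma pauli_string_in_group: "P \<in> pauli_strings k \<Longrightarrow> P \<in> pauli_group k"
  unfolding pauli_group_def by (metis (mono_tags, lifting) insertI1 mem_Collect_eq one_smult_mat)

lemma pauli_group_carrier: "g \<in> pauli_group k \<Longrightarrow> g \<in> carrier_mat (2^k) (2^k)"
  by (elim pauli_groupE) (simp add: pauli_string_carrier)

lemma pauli_group_mult:
  assumes "g \<in> pauli_group k" "h \<in> pauli_group k"
  shows "g * h \<in> pauli_group k"
proof -
  obtain c P where c: "c \<in> phases" "P \<in> pauli_strings k" "g = c \<cdot>\<^sub>m P" using assms(1) by (rule pauli_groupE)
  obtain e Q where e: "e \<in> phases" "Q \<in> pauli_strings k" "h = e \<cdot>\<^sub>m Q" using assms(2) by (rule pauli_groupE)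
  obtain f R where f: "f \<in> phases" "R \<in> pauli_strings k" "P * Q = f \<cdot>\<^sub>m R"
    using pauli_string_mult_closed[OF c(2) e(2)] by blast
  note PQ = pauli_string_carrier[OF c(2)] pauli_string_carrier[OF e(2)]
  have "g * h = c \<cdot>\<^sub>m (P * (e \<cdot>\<^sub>m Q))"
    unfolding c(3) e(3) by (rule mult_smult_assoc_mat[OF PQ(1)]) (use PQ in auto)
  also have "P * (e \<cdot>\<^sub>m Q) = e \<cdot>\<^sub>m (P * Q)"
    by (rule mult_smult_distrib[OF PQ])
  finally have "g * h = (c * e * f) \<cdot>\<^sub>m R" by (simp add: f(3) mult.assoc)
  moreover have "c * e * f \<in> phases" using c(1) e(1) f(1) by auto
  ultimately show ?thesis using f(2) unfolding pauli_group_def by blast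
qed

subsection \<open>Stabilizer bases\<close>

lemma mult_proj_eigen:
  assumes "A \<in> carrier_mat d d" "v \<in> carrier_vec d" "A *\<^sub>v v = c \<cdot>\<^sub>v v"
  shows "A * proj v = c \<cdot>\<^sub>m proj v"
proof -
  have k: "ket v \<in> carrier_mat d 1" "bra v \<in> carrier_mat 1 d" using assms(2) by auto
  have "A * proj v = (A * ket v) * bra v"
    unfolding proj_def by (rule assoc_mult_mat[OF assms(1) k, symmetric])
  also have "A * ket v = c \<cdot>\<^sub>m ket v"
    by (simp add: mult_ket[OF assms(1,2)] assms(3)) (auto simp: ket_def)
  also have "(c \<cdot>\<^sub>m ket v) * bra v = c \<cdot>\<^sub>m proj v"
    unfolding proj_def by (rule mult_smult_assoc_mat[OF k])
  finally show ?thesis .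
qed

lemma adj_proj: "v \<in> carrier_vec d \<Longrightarrow> adj (proj v) = proj v"
  by (simp add: proj_def bra_eq_adj_ket adj_mult[OF ket_carrier adj_carrier[OF ket_carrier]])

text \<open>Since \<open>proj v\<close> fixes \<open>v\<close>, commuting it past \<open>A\<close>
  shows that \<open>A *\<^sub>v v\<close> lies in the range of \<open>proj v\<close>, which is the
  line through \<open>v\<close>; the eigenvalue is then the expectation of \<open>A\<close>.\<close>

lemma proj_commute_eigen:
  assumes A: "A \<in> carrier_mat d d" and v: "v \<in> carrier_vec d" "vinner v v = 1"
    and "A * proj v = proj v * A"
  shows "A *\<^sub>v v = vinner v (A *\<^sub>v v) \<cdot>\<^sub>v v"
proof -
  note p = proj_carrier[OF v(1)]
  have "A *\<^sub>v v = A *\<^sub>v (proj v *\<^sub>v v)" using v by (simp add: proj_mult_vec[OF v(1) v(1)])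
  also have "\<dots> = (A * proj v) *\<^sub>v v" by (rule assoc_mult_mat_vec[OF A p v(1), symmetric])
  also have "\<dots> = proj v *\<^sub>v (A *\<^sub>v v)" unfolding assms(4) by (rule assoc_mult_mat_vec[OF p A v(1)])
  also have "\<dots> = vinner v (A *\<^sub>v v) \<cdot>\<^sub>v v" using A v by (intro proj_mult_vec) auto
  finally show ?thesis .
qed

lemma smult_vec_inject:
  assumes "v \<in> carrier_vec d" "vinner v v = 1" "a \<cdot>\<^sub>v v = b \<cdot>\<^sub>v v"
  shows "a = b"
  using arg_cong[OF assms(3), of "vinner v"] assms(1,2) by (simp add: vinner_smult_right)

lemma orthonormal_basisD:
  assumes "orthonormal_basis d \<Phi>" "b < d"
  shows "\<Phi> b \<in> carrier_vec d" "vinner (\<Phi> b) (\<Phi> b) = 1"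
    "b' < d \<Longrightarrow> b \<noteq> b' \<Longrightarrow> vinner (\<Phi> b) (\<Phi> b') = 0"
  using assms by (auto simp: orthonormal_basis_def)

text \<open>With the basis vectors as columns of \<open>U\<close>, orthonormality says that
  \<open>adj U\<close> is a left inverse. For a square matrix it is then a right inverse, and
  \<open>U * adj U\<close> is the sum of the projections.\<close>

lemma onb_complete:
  assumes "orthonormal_basis d \<Phi>"
  shows "msum d d (\<lambda>b. proj (\<Phi> b)) {..<d} = 1\<^sub>m d"
proof -
  define U where "U = mat d d (\<lambda>(i,b). \<Phi> b $ i)"
  have U: "U \<in> carrier_mat d d" by (simp add: U_def)
  note aU = adj_carrier[OF U]
  have "adj U * U = 1\<^sub>m d"
  proof (rule eq_matI)
    fix i j assume "i < dim_row (1\<^sub>m d)" "j < dim_col (1\<^sub>m d)"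
    then have ij: "i < d" "j < d" by auto
    have "(adj U * U) $$ (i,j) = vinner (\<Phi> i) (\<Phi> j)"
      using ij orthonormal_basisD(1)[OF assms ij(1)]
      by (simp add: index_mult_mat_sum[OF aU U]) (simp add: adj_def U_def vinner_def)
    also have "\<dots> = 1\<^sub>m d $$ (i,j)"
      using ij assms by (auto simp: orthonormal_basis_def)
    finally show "(adj U * U) $$ (i,j) = 1\<^sub>m d $$ (i,j)" .
  qed (use U in \<open>auto simp: adj_def\<close>)
  then have "U * adj U = 1\<^sub>m d"
    by (rule mat_mult_left_right_inverse[OF aU U])
  moreover have "msum d d (\<lambda>b. proj (\<Phi> b)) {..<d} = U * adj U"
  proof (rule eq_matI)
    fix i j assume "i < dim_row (U * adj U)" "j < dim_col (U * adj U)"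
    then have ij: "i < d" "j < d" using U by (auto simp: adj_def)
    then show "msum d d (\<lambda>b. proj (\<Phi> b)) {..<d} $$ (i,j) = (U * adj U) $$ (i,j)"
      using orthonormal_basisD(1)[OF assms]
      by (simp add: index_mult_mat_sum[OF U aU])
        (simp add: msum_def proj_index[of _ d] adj_def U_def)
  qed (use U in \<open>auto simp: msum_def adj_def\<close>)
  ultimately show ?thesis by simp
qed

lemma onb_diag_expansion:
  assumes "orthonormal_basis d \<Phi>" "A \<in> carrier_mat d d" "\<And>b. b < d \<Longrightarrow> A *\<^sub>v \<Phi> b = e b \<cdot>\<^sub>v \<Phi> b"
  shows "A = msum d d (\<lambda>b. e b \<cdot>\<^sub>m proj (\<Phi> b)) {..<d}"
proof -
  have "A = A * msum d d (\<lambda>b. proj (\<Phi> b)) {..<d}"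
    unfolding onb_complete[OF assms(1)] using assms(2) by simp
  also have "\<dots> = msum d d (\<lambda>b. A * proj (\<Phi> b)) {..<d}"
    using orthonormal_basisD(1)[OF assms(1)] by (intro mult_msum[OF assms(2)]) auto
  also have "\<dots> = msum d d (\<lambda>b. e b \<cdot>\<^sub>m proj (\<Phi> b)) {..<d}"
    using orthonormal_basisD(1)[OF assms(1)] assms(2,3) by (intro msum_cong mult_proj_eigen) auto
  finally show ?thesis .
qed

text \<open>Both matrices have the same spectral expansion, namely the one with coefficients
  \<open>e\<close>.\<close>

lemma onb_diag_eqI:
  assumes "orthonormal_basis d \<Phi>" "A \<in> carrier_mat d d" "B \<in> carrier_mat d d"
    and "\<And>b. b < d \<Longrightarrow> A *\<^sub>v \<Phi> b = e b \<cdot>\<^sub>v \<Phi> b" "\<And>b. b < d \<Longrightarrow> B *\<^sub>v \<Phi> b = e b \<cdot>\<^sub>v \<Phi> b"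
  shows "A = B"
  using onb_diag_expansion[OF assms(1,2,4)] onb_diag_expansion[OF assms(1,3,5)] by simp

lemma onb_diag_tr:
  assumes "orthonormal_basis d \<Phi>" "A \<in> carrier_mat d d" "\<And>b. b < d \<Longrightarrow> A *\<^sub>v \<Phi> b = e b \<cdot>\<^sub>v \<Phi> b"
  shows "tr A = (\<Sum>b<d. e b)"
proof -
  note o = orthonormal_basisD[OF assms(1)]
  have "tr A = (\<Sum>b<d. tr (e b \<cdot>\<^sub>m proj (\<Phi> b)))"
    using o(1) by (subst onb_diag_expansion[OF assms]) (auto intro!: tr_msum)
  also have "\<dots> = (\<Sum>b<d. e b)"
    by (intro sum.cong) (simp_all add: tr_smult[OF proj_carrier[OF o(1)]] tr_proj[OF o(1)] o(2))
  finally show ?thesis .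
qed

lemma mult_eigen:
  fixes A B :: "complex mat"
  assumes "A \<in> carrier_mat d d" "B \<in> carrier_mat d d" "v \<in> carrier_vec d"
    and "A *\<^sub>v v = a \<cdot>\<^sub>v v" "B *\<^sub>v v = b \<cdot>\<^sub>v v"
  shows "(A * B) *\<^sub>v v = (a * b) \<cdot>\<^sub>v v"
proof -
  have "(A * B) *\<^sub>v v = A *\<^sub>v (b \<cdot>\<^sub>v v)"
    by (simp only: assoc_mult_mat_vec[OF assms(1-3)] assms(5))
  also have "\<dots> = b \<cdot>\<^sub>v (a \<cdot>\<^sub>v v)"
    by (simp only: mult_mat_vec[OF assms(1,3)] assms(4))
  finally show ?thesis by (simp add: smult_smult_assoc mult.commute)
qed

text \<open>Pauli strings square to the identity, so an eigenvalue squares to 1.\<close>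

lemma pauli_eigenvalue:
  assumes "P \<in> pauli_strings k" "v \<in> carrier_vec (2^k)" "vinner v v = 1" "P *\<^sub>v v = e \<cdot>\<^sub>v v"
  shows "e \<in> {1,-1}"
proof -
  note P = pauli_string_carrier[OF assms(1)]
  have "(e * e) \<cdot>\<^sub>v v = (P * P) *\<^sub>v v" by (rule mult_eigen[OF P P assms(2,4,4), symmetric])
  also have "\<dots> = 1 \<cdot>\<^sub>v v" using assms(2) by (simp add: pauli_string_mult_self[OF assms(1)])
  finally have "e * e = 1" by (rule smult_vec_inject[OF assms(2,3)])
  then show ?thesis by (simp add: square_eq_1_iff)
qed

lemma mat_prod_list_Cons: "mat_prod_list d (A # As) = A * mat_prod_list d As"
  by (simp add: mat_prod_list_def)

lemma mat_prod_list_Nil: "mat_prod_list d [] = 1\<^sub>m d"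
  by (simp add: mat_prod_list_def)

lemma mat_prod_list_pauli_group:
  "set As \<subseteq> pauli_group k \<Longrightarrow> mat_prod_list (2^k) As \<in> pauli_group k"
  by (induction As) (auto simp: mat_prod_list_Cons mat_prod_list_Nil
      intro: pauli_group_mult pauli_string_in_group one_pauli_string)

lemma mat_prod_list_eigen:
  assumes "v \<in> carrier_vec d"
  shows "(\<And>i. i \<in> set xs \<Longrightarrow> g i \<in> carrier_mat d d \<and> g i *\<^sub>v v = e i \<cdot>\<^sub>v v) \<Longrightarrow>
    mat_prod_list d (map g xs) \<in> carrier_mat d d \<and>
    mat_prod_list d (map g xs) *\<^sub>v v = prod_list (map e xs) \<cdot>\<^sub>v v"
proof (induction xs)
  case Nil
  then show ?case using assms by (simp add: mat_prod_list_Nil)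
next
  case (Cons x xs)
  then have IH: "mat_prod_list d (map g xs) \<in> carrier_mat d d"
    "mat_prod_list d (map g xs) *\<^sub>v v = prod_list (map e xs) \<cdot>\<^sub>v v" by auto
  have x: "g x \<in> carrier_mat d d" "g x *\<^sub>v v = e x \<cdot>\<^sub>v v" using Cons.prems by auto
  show ?case
    using mult_eigen[OF x(1) IH(1) assms x(2) IH(2)] x(1) IH(1) by (auto simp: mat_prod_list_Cons)
qed

text \<open>The matrix product runs through \<open>T\<close> in increasing order, but eigenvalues
  are numbers, so on the right only the set \<open>T\<close> matters.\<close>

lemma mat_prod_set_eigen:
  assumes "v \<in> carrier_vec d" "finite T" "\<And>i. i \<in> T \<Longrightarrow> g i \<in> carrier_mat d d \<and> g i *\<^sub>v v = e i \<cdot>\<^sub>v v"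
  shows "mat_prod_list d (map g (sorted_list_of_set T)) *\<^sub>v v = (\<Prod>i\<in>T. e i) \<cdot>\<^sub>v v"
  using mat_prod_list_eigen[OF assms(1), of "sorted_list_of_set T" g e] assms(2,3)
    prod.distinct_set_conv_list[of "sorted_list_of_set T" e] by simp

lemma commute_of_onb_diag:
  fixes A B :: "complex mat"
  assumes "orthonormal_basis d \<Phi>" "A \<in> carrier_mat d d" "B \<in> carrier_mat d d"
    and "\<And>b. b < d \<Longrightarrow> A *\<^sub>v \<Phi> b = e b \<cdot>\<^sub>v \<Phi> b" "\<And>b. b < d \<Longrightarrow> B *\<^sub>v \<Phi> b = f b \<cdot>\<^sub>v \<Phi> b"
  shows "A * B = B * A"
proof (rule onb_diag_eqI[OF assms(1)])
  fix b assume b: "b < d"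
  note v = orthonormal_basisD(1)[OF assms(1) b]
  show "(A * B) *\<^sub>v \<Phi> b = (e b * f b) \<cdot>\<^sub>v \<Phi> b"
    by (rule mult_eigen[OF assms(2,3) v assms(4,5)[OF b]])
  show "(B * A) *\<^sub>v \<Phi> b = (e b * f b) \<cdot>\<^sub>v \<Phi> b"
    by (subst mult.commute) (rule mult_eigen[OF assms(3,2) v assms(5,4)[OF b]])
qed (use assms in auto)

text \<open>The averages \<open>2\<^sup>-\<^sup>k \<Sum>\<^sub>T \<lambda>\<^sub>T(b)\<^sup>-\<^sup>1 g\<^sub>T\<close> over products of generators are diagonal in the basis with
  eigenvalues 0 and 1, have eigenvalue 1 at \<open>b\<close>, and have trace 1 because the nontrivial products are
  traceless; hence they are the projections onto the basis vectors.\<close>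

lemma stabilizer_basis_expansion:
  assumes "stabilizer_basis k \<Phi>"
  obtains p \<kappa> where "\<And>T. T \<subseteq> {..<k} \<Longrightarrow> p T \<in> pauli_strings k"
    and "\<And>S T. S \<subseteq> {..<k} \<Longrightarrow> T \<subseteq> {..<k} \<Longrightarrow> p S * p T = p T * p S"
    and "\<And>b. b < 2^k \<Longrightarrow> proj (\<Phi> b) = msum (2^k) (2^k) (\<lambda>T. \<kappa> b T \<cdot>\<^sub>m p T) (Pow {..<k})"
proof -
  define D :: nat where "D = 2^k"
  have onb: "orthonormal_basis D \<Phi>" using assms by (simp only: stabilizer_basis_def D_def)
  from assms[unfolded stabilizer_basis_def, folded D_def, THEN conjunct2] obtain g
    where gens: "(\<forall>i<k. g i \<in> pauli_group k) \<and> (\<forall>i<k. \<forall>j<k. g i * g j = g j * g i) \<and>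
        (\<forall>T. T \<subseteq> {..<k} \<and> T \<noteq> {} \<longrightarrow>
            (\<forall>c. mat_prod_list D (map g (sorted_list_of_set T)) \<noteq> c \<cdot>\<^sub>m 1\<^sub>m D)) \<and>
        (\<forall>b<D. \<forall>i<k. \<exists>ev. g i *\<^sub>v \<Phi> b = ev \<cdot>\<^sub>v \<Phi> b)"
    by (rule exE)
  have g: "g i \<in> pauli_group k" if "i < k" for i
    using gens that by simp
  have indep: "mat_prod_list D (map g (sorted_list_of_set T)) \<noteq> c \<cdot>\<^sub>m 1\<^sub>m D"
    if "T \<subseteq> {..<k}" "T \<noteq> {}" for T c
    using gens that by simp
  have ev: "\<exists>ev. g i *\<^sub>v \<Phi> b = ev \<cdot>\<^sub>v \<Phi> b" if "b < D" "i < k" for i b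
    using gens that by simp
  note o = orthonormal_basisD[OF onb]
  define l where "l i b = (SOME ev. g i *\<^sub>v \<Phi> b = ev \<cdot>\<^sub>v \<Phi> b)" for i b
  have l: "g i *\<^sub>v \<Phi> b = l i b \<cdot>\<^sub>v \<Phi> b" if "i < k" "b < D" for i b
    unfolding l_def by (rule someI_ex) (rule ev[OF that(2,1)])
  have gc: "g i \<in> carrier_mat D D" if "i < k" for i
    using pauli_group_carrier[OF g[OF that]] by (simp add: D_def)
  \<comment> \<open>A generator carries a phase \<open>a\<close>, possibly imaginary, so its
    eigenvalues are \<open>a\<close> and \<open>-a\<close> rather than signs. Quotients of two
    eigenvalues of one generator are signs whatever the phase, and only these quotients enter
    below.\<close>
  have ratio: "l i b \<noteq> 0 \<and> (l i c / l i b = 1 \<or> l i c / l i b = -1)" if i: "i < k" and bc: "b < D" "c < D" for i b c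
  proof -
    obtain a P where a: "a \<in> phases" "P \<in> pauli_strings k" "g i = a \<cdot>\<^sub>m P"
      using g[OF i] by (rule pauli_groupE)
    have a0: "a \<noteq> 0" using a(1) by auto
    note P = pauli_string_carrier[OF a(2), folded D_def]
    have *: "l i b \<in> {a, -a}" if b: "b < D" for b
    proof -
      have "P *\<^sub>v \<Phi> b = (1/a) \<cdot>\<^sub>v (g i *\<^sub>v \<Phi> b)"
        unfolding a(3) using a0 by (simp add: smult_mult_mat_vec[OF P o(1)[OF b]] smult_smult_assoc)
      also have "\<dots> = (l i b / a) \<cdot>\<^sub>v \<Phi> b"
        using l[OF i b] by (simp add: smult_smult_assoc)
      finally have "l i b / a \<in> {1,-1}"
        by (intro pauli_eigenvalue[OF a(2) o(1)[OF b, unfolded D_def] o(2)[OF b]])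
      then show ?thesis using a0 by (auto simp: field_simps)
    qed
    show ?thesis using *[OF bc(1)] *[OF bc(2)] a0 by auto
  qed
  define G where "G T = mat_prod_list D (map g (sorted_list_of_set T))" for T
  have Gpg: "G T \<in> pauli_group k" if "T \<subseteq> {..<k}" for T
    unfolding G_def D_def using that g finite_subset[OF that]
    by (intro mat_prod_list_pauli_group) auto
  have Gc: "G T \<in> carrier_mat D D" if "T \<subseteq> {..<k}" for T
    using pauli_group_carrier[OF Gpg[OF that]] by (simp add: D_def)
  have Gev: "G T *\<^sub>v \<Phi> b = (\<Prod>i\<in>T. l i b) \<cdot>\<^sub>v \<Phi> b" if "T \<subseteq> {..<k}" "b < D" for T b
    unfolding G_def using that finite_subset[OF that(1)] gc l o(1)
    by (intro mat_prod_set_eigen) auto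
  have "\<forall>T\<in>Pow {..<k}. \<exists>aP. fst aP \<in> phases \<and> snd aP \<in> pauli_strings k \<and> G T = fst aP \<cdot>\<^sub>m snd aP"
  proof
    fix T assume "T \<in> Pow {..<k}"
    then have "G T \<in> pauli_group k" using Gpg by blast
    then obtain a P where "a \<in> phases" "P \<in> pauli_strings k" "G T = a \<cdot>\<^sub>m P" by (rule pauli_groupE)
    then show "\<exists>aP. fst aP \<in> phases \<and> snd aP \<in> pauli_strings k \<and> G T = fst aP \<cdot>\<^sub>m snd aP"
      by (intro exI[of _ "(a,P)"]) simp
  qed
  from bchoice[OF this] obtain aP where aP: "\<And>T. T \<subseteq> {..<k} \<Longrightarrow> fst (aP T) \<in> phases \<and>
      snd (aP T) \<in> pauli_strings k \<and> G T = fst (aP T) \<cdot>\<^sub>m snd (aP T)"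
    by blast
  define a where "a = fst \<circ> aP"
  define p where "p = snd \<circ> aP"
  have a: "a T \<noteq> 0" and p: "p T \<in> pauli_strings k" and Gap: "G T = a T \<cdot>\<^sub>m p T" if "T \<subseteq> {..<k}" for T
    using aP[OF that] by (auto simp: a_def p_def)
  have pc: "p T \<in> carrier_mat D D" if "T \<subseteq> {..<k}" for T
    using pauli_string_carrier[OF p[OF that]] by (simp add: D_def)
  \<comment> \<open>If the string behind a nonempty product were the identity, the product would be
    the scalar \<open>a T\<close>, contrary to independence modulo phases; any other string is
    traceless.\<close>
  have trG: "tr (G T) = (if T = {} then of_nat D else 0)" if T: "T \<subseteq> {..<k}" for T
  proof (cases "T = {}")
    case True
    then show ?thesis by (simp add: G_def mat_prod_list_Nil tr_one)
  next
    case False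
    then have "p T \<noteq> 1\<^sub>m D" using indep[OF T False, of "a T"] Gap[OF T] by (auto simp: G_def)
    then have "tr (p T) = 0" using pauli_string_tr[OF p[OF T]] by (auto simp: D_def)
    with False show ?thesis by (simp add: Gap[OF T] tr_smult[OF pc[OF T]])
  qed
  \<comment> \<open>The weights make the sum over subsets factor: \<open>M b\<close> acts on
    \<open>\<Phi> c\<close> as the product over all generators of
    \<open>(1 + l i c / l i b) / 2\<close>. A factor is 1 where the eigenvalues at \<open>b\<close>
    and \<open>c\<close> agree and 0 where they are opposite; the \<open>k\<close> halves are
    collected in \<open>1 / of_nat D\<close>.\<close>
  define w where "w b T = (1 / of_nat D) * (\<Prod>i\<in>T. 1 / l i b)" for b T
  define M where "M b = msum D D (\<lambda>T. w b T \<cdot>\<^sub>m G T) (Pow {..<k})" for b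
  define e where "e b c = (1 / of_nat D) * (\<Prod>i<k. 1 + l i c / l i b)" for b c
  have Mev: "M b *\<^sub>v \<Phi> c = e b c \<cdot>\<^sub>v \<Phi> c" if bc: "b < D" "c < D" for b c
  proof -
    have "M b *\<^sub>v \<Phi> c = (\<Sum>T\<in>Pow {..<k}. w b T * (\<Prod>i\<in>T. l i c)) \<cdot>\<^sub>v \<Phi> c"
      unfolding M_def
      by (rule msum_mult_vec)
        (use o(1) bc Gc Gev in \<open>auto simp: smult_mult_mat_vec[OF Gc] smult_smult_assoc\<close>)
    also have "(\<Sum>T\<in>Pow {..<k}. w b T * (\<Prod>i\<in>T. l i c)) = e b c"
      unfolding e_def using prod_add[of "{..<k}" "\<lambda>i. l i c / l i b" "\<lambda>_. 1"]
      by (simp add: w_def sum_distrib_left add.commute prod_dividef)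
    finally show ?thesis .
  qed
  have e01: "e b c = 0 \<or> e b c = 1" if bc: "b < D" "c < D" for b c
  proof (cases "\<exists>i<k. l i c / l i b = -1")
    case True
    then obtain i where "i < k" "l i c / l i b = -1" by blast
    then have "(\<Prod>i<k. 1 + l i c / l i b) = 0" by (intro prod_zero) (auto intro!: bexI[of _ i])
    then show ?thesis by (simp add: e_def)
  next
    case False
    then have "l i c / l i b = 1" if "i < k" for i using ratio[OF that bc] that by blast
    then have "(\<Prod>i<k. 1 + l i c / l i b) = 2^k" by simp
    then show ?thesis by (simp add: e_def D_def)
  qed
  have ebb: "e b b = 1" if b: "b < D" for b
  proof -
    have "l i b / l i b = 1" if "i < k" for i using ratio[OF that b b] by simp
    then have "(\<Prod>i<k. 1 + l i b / l i b) = 2^k" by simp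
    then show ?thesis by (simp add: e_def D_def)
  qed
  have projM: "proj (\<Phi> b) = M b" if b: "b < D" for b
  proof -
    have "tr (M b) = (\<Sum>T\<in>Pow {..<k}. tr (w b T \<cdot>\<^sub>m G T))"
      unfolding M_def using Gc by (intro tr_msum) auto
    also have "\<dots> = (\<Sum>T\<in>Pow {..<k}. if T = {} then 1 else 0)"
      using trG Gc by (intro sum.cong) (auto simp: tr_smult[OF Gc] w_def D_def)
    finally have "tr (M b) = 1" by simp
    moreover have "tr (M b) = (\<Sum>c<D. e b c)"
      using Mev[OF b] by (intro onb_diag_tr[OF onb]) (auto simp: M_def)
    moreover have "(\<Sum>c<D. e b c) = of_nat (card {c. c < D \<and> e b c = 1})"
    proof -
      have "(\<Sum>c<D. e b c) = (\<Sum>c<D. if e b c = 1 then 1 else 0)"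
        using e01[OF b] by (intro sum.cong) auto
      also have "\<dots> = of_nat (card ({..<D} \<inter> {c. e b c = 1}))"
        by (simp add: sum.If_cases)
      also have "{..<D} \<inter> {c. e b c = 1} = {c. c < D \<and> e b c = 1}" by auto
      finally show ?thesis .
    qed
    ultimately have "of_nat (card {c. c < D \<and> e b c = 1}) = (1::complex)" by (simp only:)
    then have "card {c. c < D \<and> e b c = 1} = 1" by (simp only: of_nat_eq_1_iff)
    then obtain x where x: "{c. c < D \<and> e b c = 1} = {x}" by (rule card_1_singletonE)
    have "b \<in> {c. c < D \<and> e b c = 1}" using ebb[OF b] b by blast
    then have "x = b" by (simp only: x singleton_iff)
    then have ne: "e b c = 0" if "c < D" "c \<noteq> b" for c
    proof -
      have "c \<notin> {c. c < D \<and> e b c = 1}" using that(2) by (simp add: x \<open>x = b\<close>)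
      then show ?thesis using e01[OF b that(1)] that(1) by blast
    qed
    show ?thesis
    proof (rule onb_diag_eqI[OF onb])
      fix c assume c: "c < D"
      show "M b *\<^sub>v \<Phi> c = e b c \<cdot>\<^sub>v \<Phi> c" by (rule Mev[OF b c])
      show "proj (\<Phi> b) *\<^sub>v \<Phi> c = e b c \<cdot>\<^sub>v \<Phi> c"
      proof (cases "c = b")
        case True
        then show ?thesis by (simp add: proj_mult_vec[OF o(1)[OF b] o(1)[OF b]] o(2)[OF b] ebb[OF b])
      next
        case False
        \<comment> \<open>The result is the zero vector, recast as a multiple of
          \<open>\<Phi> c\<close> to match the common form of both eigenvector equations.\<close>
        have "proj (\<Phi> b) *\<^sub>v \<Phi> c = 0 \<cdot>\<^sub>v \<Phi> b"
          using False o(3)[OF b c] by (simp add: proj_mult_vec[OF o(1)[OF b] o(1)[OF c]])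
        also have "\<dots> = 0 \<cdot>\<^sub>v \<Phi> c"
          using o(1)[OF b] o(1)[OF c] by (intro eq_vecI) auto
        finally show ?thesis using ne[OF c False] by simp
      qed
    qed (use o(1)[OF b] in \<open>auto simp: M_def\<close>)
  qed
  show ?thesis
  proof (rule that[of p "\<lambda>b T. w b T * a T"])
    fix S T assume ST: "S \<subseteq> {..<k}" "T \<subseteq> {..<k}"
    \<comment> \<open>Dividing by the phase carries the eigenvector equation from the product
      \<open>G T\<close> to its string. Strings that are diagonal in the same basis commute.\<close>
    have pev: "p T *\<^sub>v \<Phi> b = ((\<Prod>i\<in>T. l i b) / a T) \<cdot>\<^sub>v \<Phi> b" if "T \<subseteq> {..<k}" "b < D" for T b
    proof -
      have "p T *\<^sub>v \<Phi> b = (1 / a T) \<cdot>\<^sub>v (G T *\<^sub>v \<Phi> b)"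
        using a[OF that(1)] by (simp add: Gap[OF that(1)] smult_mult_mat_vec[OF pc[OF that(1)] o(1)[OF that(2)]] smult_smult_assoc)
      then show ?thesis using Gev[OF that] by (simp add: smult_smult_assoc)
    qed
    show "p S * p T = p T * p S"
      using pev[OF ST(1)] pev[OF ST(2)] by (rule commute_of_onb_diag[OF onb pc[OF ST(1)] pc[OF ST(2)]])
  next
    fix b :: nat assume "b < 2^k"
    then have "proj (\<Phi> b) = M b" by (intro projM) (simp only: D_def)
    also have "\<dots> = msum D D (\<lambda>T. (w b T * a T) \<cdot>\<^sub>m p T) (Pow {..<k})"
      unfolding M_def by (intro msum_cong) (simp add: Gap)
    finally show "proj (\<Phi> b) = msum (2^k) (2^k) (\<lambda>T. (w b T * a T) \<cdot>\<^sub>m p T) (Pow {..<k})"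
      by (simp only: D_def)
  qed (use p in auto)
qed

subsection \<open>Stabilizer states and the effective POVM\<close>

lemma msum_reindex:
  assumes "bij_betw h I J"
  shows "msum a b (\<lambda>t. f (h t)) I = msum a b f J"
proof -
  have "(\<Sum>t\<in>I. f (h t) $$ ij) = (\<Sum>t\<in>J. f t $$ ij)" for ij
    by (rule sum.reindex_bij_betw[OF assms])
  then show ?thesis by (simp add: msum_def)
qed

lemma msum_mono_neutral:
  assumes "finite J" "I \<subseteq> J" "\<And>t. t \<in> J - I \<Longrightarrow> f t = 0\<^sub>m a b"
  shows "msum a b f J = msum a b f I"
proof (rule eq_matI)
  fix i j assume "i < dim_row (msum a b f I)" "j < dim_col (msum a b f I)"
  then have ij: "i < a" "j < b" by (auto simp: msum_def)
  have "(\<Sum>t\<in>J. f t $$ (i,j)) = (\<Sum>t\<in>I. f t $$ (i,j))"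
    using assms ij by (intro sum.mono_neutral_right) auto
  then show "msum a b f J $$ (i,j) = msum a b f I $$ (i,j)" using ij by (simp add: msum_def)
qed (simp_all add: msum_def)

lemma tr_minus:
  "A \<in> carrier_mat d d \<Longrightarrow> B \<in> carrier_mat d d \<Longrightarrow> tr (A - B) = tr A - tr B"
  by (auto simp: tr_def sum_subtractf)

lemma adj_minus:
  "A \<in> carrier_mat a b \<Longrightarrow> B \<in> carrier_mat a b \<Longrightarrow> adj (A - B) = adj A - adj B"
  by (rule eq_matI) (auto simp: adj_def)

text \<open>For Hermitian \<open>E\<close> the trace of \<open>E * E\<close> is the sum of the
  squared moduli of all entries.\<close>

lemma hermitian_eq_zero:
  assumes E: "E \<in> carrier_mat d d" "adj E = E" "tr (E * E) = 0"
  shows "E = 0\<^sub>m d d"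
proof -
  have h: "E $$ (k,i) = cnj (E $$ (i,k))" if "i < d" "k < d" for i k
  proof -
    have "E $$ (k,i) = adj E $$ (k,i)" by (simp add: E(2))
    also have "\<dots> = cnj (E $$ (i,k))" using E(1) that by (simp add: adj_def)
    finally show ?thesis .
  qed
  have "tr (E * E) = (\<Sum>i<d. \<Sum>k<d. E $$ (i,k) * E $$ (k,i))"
    using E(1) by (simp add: tr_def index_mult_mat_sum[OF E(1) E(1)])
  also have "\<dots> = (\<Sum>i<d. \<Sum>k<d. complex_of_real ((cmod (E $$ (i,k)))\<^sup>2))"
  proof (intro sum.cong refl)
    fix i k assume "i \<in> {..<d}" "k \<in> {..<d}"
    then have "E $$ (k,i) = cnj (E $$ (i,k))" by (intro h) auto
    then show "E $$ (i,k) * E $$ (k,i) = complex_of_real ((cmod (E $$ (i,k)))\<^sup>2)"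
      by (simp only: complex_norm_square)
  qed
  finally have "complex_of_real (\<Sum>i<d. \<Sum>k<d. (cmod (E $$ (i,k)))\<^sup>2) = 0" using E(3) by simp
  then have "(\<Sum>i<d. \<Sum>k<d. (cmod (E $$ (i,k)))\<^sup>2) = 0" by (simp only: of_real_eq_0_iff)
  then have "E $$ (i,k) = 0" if "i < d" "k < d" for i k
    using that by (simp add: sum_nonneg_eq_0_iff sum_nonneg)
  then show ?thesis using E(1) by (intro eq_matI) auto
qed

text \<open>Two Hermitian idempotents, one of them below the other, coincide as soon as their traces do.\<close>

lemma stabilizer_group_proj:
  assumes S: "stabilizer_group m S" and \<psi>: "\<psi> \<in> carrier_vec (2^m)" "vinner \<psi> \<psi> = 1"
    and stab: "\<And>s. s \<in> S \<Longrightarrow> s *\<^sub>v \<psi> = \<psi>"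
  shows "proj \<psi> = msum (2^m) (2^m) (\<lambda>s. (1 / 2^m) \<cdot>\<^sub>m s) S"
proof -
  define D :: nat where "D = 2^m"
  define R where "R = msum D D (\<lambda>s. (1 / of_nat D) \<cdot>\<^sub>m s) S"
  have pg: "s \<in> pauli_group m" if "s \<in> S" for s
    using S that by (auto simp: stabilizer_group_def)
  have one: "1\<^sub>m D \<in> S" and card: "card S = D" and neg: "- (1\<^sub>m D) \<notin> S"
    using S by (auto simp: stabilizer_group_def D_def)
  have mult: "s * t \<in> S" and comm: "s * t = t * s" if "s \<in> S" "t \<in> S" for s t
    using S that by (auto simp: stabilizer_group_def)
  have inv: "\<exists>t\<in>S. s * t = 1\<^sub>m D" if "s \<in> S" for s
    using S that unfolding stabilizer_group_def D_def by blast
  have fin: "finite S" using card by (intro card_ge_0_finite) (simp add: D_def)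
  have Sc: "s \<in> carrier_mat D D" if "s \<in> S" for s
    using pauli_group_carrier[OF pg[OF that]] by (simp add: D_def)
  have real: "\<exists>c\<in>{1,-1}. \<exists>P\<in>pauli_strings m. s = c \<cdot>\<^sub>m P" if s: "s \<in> S" for s
  proof -
    obtain c P where c: "c \<in> phases" "P \<in> pauli_strings m" "s = c \<cdot>\<^sub>m P"
      using pg[OF s] by (rule pauli_groupE)
    note P = pauli_string_carrier[OF c(2), folded D_def]
    have "s * s = c \<cdot>\<^sub>m (P * (c \<cdot>\<^sub>m P))"
      unfolding c(3) by (rule mult_smult_assoc_mat[OF P]) (use P in auto)
    also have "P * (c \<cdot>\<^sub>m P) = c \<cdot>\<^sub>m 1\<^sub>m D"
      unfolding mult_smult_distrib[OF P P] by (simp add: pauli_string_mult_self[OF c(2)] D_def)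
    finally have ss: "s * s = (c * c) \<cdot>\<^sub>m 1\<^sub>m D" by simp
    \<comment> \<open>An imaginary phase would make the square of \<open>s\<close> equal to minus
      the identity, which a stabilizer group excludes. All elements are therefore Hermitian.\<close>
    have "c * c \<noteq> -1"
    proof
      assume "c * c = -1"
      with ss have "s * s = - (1\<^sub>m D)" by (intro eq_matI) auto
      with mult[OF s s] neg show False by simp
    qed
    with c show ?thesis by auto
  qed
  have sadj: "adj s = s" if "s \<in> S" for s
    using real[OF that] by (auto simp: adj_smult pauli_string_adj)
  have str: "tr s = 0" if s: "s \<in> S" "s \<noteq> 1\<^sub>m D" for s
  proof -
    obtain c P where c: "c \<in> {1,-1}" "P \<in> pauli_strings m" "s = c \<cdot>\<^sub>m P" using real[OF s(1)] by blast
    have "P \<noteq> 1\<^sub>m D"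
    proof
      assume "P = 1\<^sub>m D"
      with c s have "s = - (1\<^sub>m D)" by (intro eq_matI) auto
      with s neg show False by simp
    qed
    then have "tr P = 0" using pauli_string_tr[OF c(2)] by (simp add: D_def)
    then show ?thesis by (simp add: c(3) tr_smult[OF pauli_string_carrier[OF c(2)]])
  qed
  have Rc: "R \<in> carrier_mat D D" by (simp add: R_def)
  \<comment> \<open>Multiplication by \<open>s\<close> is injective because \<open>s\<close> is
    invertible, hence a permutation of the finite group, and the average is invariant under
    it.\<close>
  have sR: "s * R = R" if s: "s \<in> S" for s
  proof -
    obtain t where t: "t \<in> S" "s * t = 1\<^sub>m D" using inv[OF s] by blast
    have ts: "t * s = 1\<^sub>m D" using t comm[OF s t(1)] by simp
    have "inj_on ((*) s) S"
    proof (rule inj_onI)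
      fix x y assume xy: "x \<in> S" "y \<in> S" "s * x = s * y"
      have "x = (t * s) * x" using Sc[OF xy(1)] by (simp add: ts)
      also have "\<dots> = (t * s) * y"
        using xy(3) by (simp only: assoc_mult_mat[OF Sc[OF t(1)] Sc[OF s] Sc[OF xy(1)]]
            assoc_mult_mat[OF Sc[OF t(1)] Sc[OF s] Sc[OF xy(2)]])
      also have "\<dots> = y" using Sc[OF xy(2)] by (simp add: ts)
      finally show "x = y" .
    qed
    moreover have "(*) s ` S \<subseteq> S" using mult[OF s] by auto
    ultimately have bij: "bij_betw ((*) s) S S"
      using endo_inj_surj[OF fin] by (auto simp: bij_betw_def)
    have "s * R = msum D D (\<lambda>x. s * ((1 / of_nat D) \<cdot>\<^sub>m x)) S"
      unfolding R_def using Sc by (intro mult_msum[OF Sc[OF s]]) auto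
    also have "\<dots> = msum D D (\<lambda>x. (1 / of_nat D) \<cdot>\<^sub>m (s * x)) S"
      by (intro msum_cong mult_smult_distrib[OF Sc[OF s] Sc])
    also have "\<dots> = R" unfolding R_def by (rule msum_reindex[OF bij])
    finally show ?thesis .
  qed
  have RR: "R * R = R"
  proof -
    have "R * R = msum D D (\<lambda>x. ((1 / of_nat D) \<cdot>\<^sub>m x) * R) S"
      by (subst (1) R_def, rule msum_mult[OF Rc]) (use Sc in auto)
    also have "\<dots> = msum D D (\<lambda>x. (1 / of_nat D) \<cdot>\<^sub>m R) S"
      by (intro msum_cong) (simp add: mult_smult_assoc_mat[OF Sc Rc] sR)
    also have "\<dots> = R"
      using Rc by (intro eq_matI) (auto simp: msum_def card D_def)
    finally show ?thesis .
  qed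
  have Radj: "adj R = R"
    unfolding R_def using Sc by (subst adj_msum) (auto simp: adj_smult sadj intro!: msum_cong)
  have "tr R = (\<Sum>s\<in>S. tr ((1 / of_nat D) \<cdot>\<^sub>m s))"
    unfolding R_def using Sc by (intro tr_msum) auto
  also have "\<dots> = (\<Sum>s\<in>S. if s = 1\<^sub>m D then 1 else 0)"
    using str by (intro sum.cong refl) (auto simp: tr_smult[OF Sc] tr_one D_def)
  also have "\<dots> = 1" using fin one by simp
  finally have Rtr: "tr R = 1" .
  have \<psi>c: "\<psi> \<in> carrier_vec D" using \<psi>(1) by (simp add: D_def)
  have "R *\<^sub>v \<psi> = (\<Sum>s\<in>S. 1 / of_nat D) \<cdot>\<^sub>v \<psi>"
    unfolding R_def by (rule msum_mult_vec) (use Sc \<psi>c stab in \<open>auto simp: smult_mult_mat_vec[OF Sc]\<close>)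
  then have R\<psi>: "R *\<^sub>v \<psi> = 1 \<cdot>\<^sub>v \<psi>" by (simp add: card D_def)
  define Q where "Q = proj \<psi>"
  have Qc: "Q \<in> carrier_mat D D" using \<psi>c by (simp add: Q_def)
  have Qadj: "adj Q = Q" using adj_proj[OF \<psi>c] by (simp add: Q_def)
  have RQ: "R * Q = Q" using mult_proj_eigen[OF Rc \<psi>c R\<psi>] by (simp add: Q_def)
  have QR: "Q * R = Q"
    using arg_cong[OF RQ, of adj] adj_mult[OF Rc Qc] by (simp add: Radj Qadj)
  have "Q *\<^sub>v \<psi> = 1 \<cdot>\<^sub>v \<psi>" using proj_mult_vec[OF \<psi>c \<psi>c] \<psi>(2) by (simp add: Q_def)
  then have QQ: "Q * Q = Q" using mult_proj_eigen[OF Qc \<psi>c, of 1] by (simp add: Q_def)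
  have RQc: "R - Q \<in> carrier_mat D D" by (rule minus_carrier_mat[OF Qc])
  \<comment> \<open>As \<open>Q\<close> lies below \<open>R\<close>, the square of the difference
    equals \<open>R - Q\<close> up to a zero term, so its trace is the difference of two traces that
    are both 1.\<close>
  have "(R - Q) * (R - Q) = (R - Q) - (Q - Q)"
    unfolding mult_minus_distrib_mat[OF RQc Rc Qc] minus_mult_distrib_mat[OF Rc Qc Rc]
      minus_mult_distrib_mat[OF Rc Qc Qc] RR RQ QR QQ ..
  then have "tr ((R - Q) * (R - Q)) = (tr R - tr Q) - (tr Q - tr Q)"
    using tr_minus[OF RQc, of "Q - Q"] tr_minus[OF Rc Qc] tr_minus[OF Qc Qc] Qc by simp
  then have "tr ((R - Q) * (R - Q)) = 0"
    using Rtr tr_proj[OF \<psi>c] \<psi>(2) by (simp add: Q_def)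
  then have z: "R - Q = 0\<^sub>m D D"
    by (intro hermitian_eq_zero RQc) (simp_all add: adj_minus[OF Rc Qc] Radj Qadj)
  have "R = Q"
  proof (rule eq_matI)
    fix i j assume "i < dim_row Q" "j < dim_col Q"
    with Qc have ij: "i < D" "j < D" by auto
    then have "(R - Q) $$ (i,j) = 0" by (simp add: z)
    then show "R $$ (i,j) = Q $$ (i,j)" using ij Qc by simp
  qed (use Rc Qc in auto)
  then show ?thesis by (simp add: R_def Q_def D_def)
qed

text \<open>Commuting a stabilizer past \<open>P\<close> inside the expectation changes nothing
  except for a sign. Anticommutation would therefore make the expectation its own negative. So
  \<open>P\<close> commutes with every stabilizer, with their average \<open>proj \<psi>\<close>,
  and consequently has \<psi> as an eigenvector.\<close>

lemma stabilizer_state_pauli_eigen: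
  assumes "stabilizer_state m \<psi>" "P \<in> pauli_strings m" "vinner \<psi> (P *\<^sub>v \<psi>) \<noteq> 0"
  shows "P *\<^sub>v \<psi> = vinner \<psi> (P *\<^sub>v \<psi>) \<cdot>\<^sub>v \<psi>"
proof -
  obtain S where \<psi>: "\<psi> \<in> carrier_vec (2^m)" "vinner \<psi> \<psi> = 1"
    and S: "stabilizer_group m S" "\<And>s. s \<in> S \<Longrightarrow> s *\<^sub>v \<psi> = \<psi>"
    using assms(1) unfolding stabilizer_state_def by blast
  note P = pauli_string_carrier[OF assms(2)]
  note P\<psi> = mult_mat_vec_carrier[OF P \<psi>(1)]
  have comm: "P * s = s * P" and sc: "s \<in> carrier_mat (2^m) (2^m)" if s: "s \<in> S" for s
  proof -
    have "s \<in> pauli_group m" using S(1) s by (auto simp: stabilizer_group_def)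
    then obtain c T where c: "c \<in> phases" "T \<in> pauli_strings m" "s = c \<cdot>\<^sub>m T" by (rule pauli_groupE)
    note T = pauli_string_carrier[OF c(2)]
    show sc: "s \<in> carrier_mat (2^m) (2^m)" using T c by simp
    have c0: "c \<noteq> 0" using c(1) by auto
    have T\<psi>: "T *\<^sub>v \<psi> = (1/c) \<cdot>\<^sub>v \<psi>"
    proof -
      have "T *\<^sub>v \<psi> = (1/c) \<cdot>\<^sub>v (s *\<^sub>v \<psi>)"
        using c0 by (simp add: c(3) smult_mult_mat_vec[OF T \<psi>(1)] smult_smult_assoc)
      then show ?thesis by (simp add: S(2)[OF s])
    qed
    have pm: "1/c \<in> {1,-1}" by (rule pauli_eigenvalue[OF c(2) \<psi> T\<psi>])
    obtain r where r: "r \<in> {1,-1}" "P * T = r \<cdot>\<^sub>m (T * P)"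
      using pauli_string_commute_sign[OF assms(2) c(2)] by blast
    \<comment> \<open>The expectation of \<open>P * T\<close> is evaluated twice: once with
      \<open>T\<close> acting on the right-hand \<psi>, once after exchanging the factors, which
      costs \<open>r\<close>, with \<open>T\<close> acting on the left-hand \<psi>. Cancelling the
      nonzero expectation of \<open>P\<close> gives \<open>r = 1\<close>, because \<open>1/c\<close>
      is real.\<close>
    have "(1/c) * vinner \<psi> (P *\<^sub>v \<psi>) = vinner \<psi> (P *\<^sub>v (T *\<^sub>v \<psi>))"
      unfolding T\<psi> mult_mat_vec[OF P \<psi>(1)] by (rule vinner_smult_right[OF \<psi>(1) P\<psi>, symmetric])
    also have "P *\<^sub>v (T *\<^sub>v \<psi>) = (r \<cdot>\<^sub>m (T * P)) *\<^sub>v \<psi>"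
      unfolding r(2)[symmetric] by (rule assoc_mult_mat_vec[OF P T \<psi>(1), symmetric])
    also have "\<dots> = r \<cdot>\<^sub>v (T *\<^sub>v (P *\<^sub>v \<psi>))"
      using smult_mult_mat_vec[OF mult_carrier_mat[OF T P] \<psi>(1)] by (simp add: assoc_mult_mat_vec[OF T P \<psi>(1)])
    also have "vinner \<psi> \<dots> = r * vinner \<psi> (T *\<^sub>v (P *\<^sub>v \<psi>))"
      by (rule vinner_smult_right[OF \<psi>(1) mult_mat_vec_carrier[OF T P\<psi>]])
    also have "vinner \<psi> (T *\<^sub>v (P *\<^sub>v \<psi>)) = cnj (1/c) * vinner \<psi> (P *\<^sub>v \<psi>)"
      unfolding vinner_mult_vec[OF T \<psi>(1) P\<psi>] pauli_string_adj[OF c(2)] T\<psi>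
      by (rule vinner_smult_left[OF \<psi>(1) P\<psi>])
    finally have "(1/c) * vinner \<psi> (P *\<^sub>v \<psi>) = (r * cnj (1/c)) * vinner \<psi> (P *\<^sub>v \<psi>)"
      by (simp only: mult.assoc)
    then have "1/c = r * cnj (1/c)" by (simp only: mult_right_cancel[OF assms(3)])
    moreover have "c = 1 \<or> c = -1" using pm c0 by (auto simp: field_simps minus_equation_iff)
    ultimately have "r = 1" by auto
    with r have PT: "P * T = T * P" by simp
    show "P * s = s * P"
      by (simp add: c(3) mult_smult_distrib[OF P T] mult_smult_assoc_mat[OF T P] PT)
  qed
  have "P * proj \<psi> = proj \<psi> * P"
    unfolding stabilizer_group_proj[OF S(1) \<psi> S(2), simplified]
  proof (rule msum_commute[OF P])
    fix s assume s: "s \<in> S"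
    show "P * ((1 / 2^m) \<cdot>\<^sub>m s) = ((1 / 2^m) \<cdot>\<^sub>m s) * P"
      by (simp add: mult_smult_distrib[OF P sc[OF s]] mult_smult_assoc_mat[OF sc[OF s] P] comm[OF s])
  qed (use sc in auto)
  then show ?thesis by (rule proj_commute_eigen[OF P \<psi>])
qed

text \<open>A Pauli string is its own inverse, so multiplying by it reduces the claim to multiples
  of the identity.\<close>

lemma pauli_smult_inject:
  assumes "P \<in> pauli_strings k" "a \<cdot>\<^sub>m P = b \<cdot>\<^sub>m P"
  shows "a = b"
proof -
  note P = pauli_string_carrier[OF assms(1)]
  have "x \<cdot>\<^sub>m 1\<^sub>m (2^k) = (x \<cdot>\<^sub>m P) * P" for x
    by (simp add: mult_smult_assoc_mat[OF P P] pauli_string_mult_self[OF assms(1)])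
  with assms(2) have "a \<cdot>\<^sub>m 1\<^sub>m (2^k) = b \<cdot>\<^sub>m 1\<^sub>m (2^k)" by metis
  from arg_cong[OF this, of "\<lambda>A. A $$ (0,0)"] show ?thesis by simp
qed

text \<open>Both strings have \<psi> as an eigenvector with nonzero eigenvalue; applying the two
  products to \<psi> gives the same number \<open>a * b\<close>, which rules out the sign
  -1.\<close>

lemma stabilizer_state_pauli_commute:
  assumes "stabilizer_state m \<psi>" "P \<in> pauli_strings m" "Q \<in> pauli_strings m"
    and nz: "vinner \<psi> (P *\<^sub>v \<psi>) \<noteq> 0" "vinner \<psi> (Q *\<^sub>v \<psi>) \<noteq> 0"
  shows "P * Q = Q * P"
proof -
  have \<psi>: "\<psi> \<in> carrier_vec (2^m)" "vinner \<psi> \<psi> = 1"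
    using assms(1) by (simp_all only: stabilizer_state_def)
  note P = pauli_string_carrier[OF assms(2)] and Q = pauli_string_carrier[OF assms(3)]
  define a where "a = vinner \<psi> (P *\<^sub>v \<psi>)"
  define b where "b = vinner \<psi> (Q *\<^sub>v \<psi>)"
  have a: "P *\<^sub>v \<psi> = a \<cdot>\<^sub>v \<psi>" unfolding a_def by (rule stabilizer_state_pauli_eigen[OF assms(1,2) nz(1)])
  have b: "Q *\<^sub>v \<psi> = b \<cdot>\<^sub>v \<psi>" unfolding b_def by (rule stabilizer_state_pauli_eigen[OF assms(1,3) nz(2)])
  obtain r where r: "P * Q = r \<cdot>\<^sub>m (Q * P)"
    using pauli_string_commute_sign[OF assms(2,3)] by blast
  have "(a * b) \<cdot>\<^sub>v \<psi> = (P * Q) *\<^sub>v \<psi>" by (rule mult_eigen[OF P Q \<psi>(1) a b, symmetric])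
  also have "\<dots> = r \<cdot>\<^sub>v ((Q * P) *\<^sub>v \<psi>)"
    unfolding r by (rule smult_mult_mat_vec[OF mult_carrier_mat[OF Q P] \<psi>(1)])
  also have "\<dots> = (r * (b * a)) \<cdot>\<^sub>v \<psi>"
    by (simp add: mult_eigen[OF Q P \<psi>(1) b a] smult_smult_assoc)
  finally have "a * b = r * (b * a)" by (rule smult_vec_inject[OF \<psi>])
  then have "r = 1" using nz by (simp add: a_def b_def)
  then show ?thesis using r by simp
qed

text \<open>The exchange sign of the full strings is the product of the signs of the two halves.
  With the full sign and the ancilla sign equal to 1, so is the data sign; the cancellation is
  legitimate because a product of strings is a nonzero multiple of a string.\<close>

lemma kron_pauli_commute_left:
  assumes A: "A \<in> pauli_strings n" "A' \<in> pauli_strings n" and B: "B \<in> pauli_strings m" "B' \<in> pauli_strings m"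
    and AB: "kron A B \<in> pauli_strings (n + m)" "kron A' B' \<in> pauli_strings (n + m)"
    and comm: "kron A B * kron A' B' = kron A' B' * kron A B" "B * B' = B' * B"
  shows "A * A' = A' * A"
proof -
  note c = pauli_string_carrier[OF A(1)] pauli_string_carrier[OF A(2)]
    pauli_string_carrier[OF B(1)] pauli_string_carrier[OF B(2)]
  obtain r where r: "A * A' = r \<cdot>\<^sub>m (A' * A)"
    using pauli_string_commute_sign[OF A] by blast
  obtain f R where f: "f \<in> phases" "R \<in> pauli_strings (n+m)" "kron A' B' * kron A B = f \<cdot>\<^sub>m R"
    using pauli_string_mult_closed[OF AB(2,1)] by blast
  have "kron A B * kron A' B' = kron (A * A') (B * B')" by (rule kron_mult[OF c(1,3,2,4)])
  also have "\<dots> = r \<cdot>\<^sub>m (kron A' B' * kron A B)"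
    unfolding kron_mult[OF c(2,4,1,3)] by (simp only: r comm(2) kron_smult_left)
  finally have "f \<cdot>\<^sub>m R = (r * f) \<cdot>\<^sub>m R" by (simp add: comm(1) f(3))
  then have "f = r * f" by (rule pauli_smult_inject[OF f(2)])
  then have "r = 1" using f(1) by auto
  then show ?thesis using r by simp
qed

text \<open>The two sides of the product act factorwise, and the ancilla factor collapses to a
  matrix of size one, which is the expectation of \<open>B\<close>.\<close>

lemma compress_kron:
  assumes "A \<in> carrier_mat a a" "B \<in> carrier_mat b b" "\<psi> \<in> carrier_vec b"
  shows "adj (kron (1\<^sub>m a) (ket \<psi>)) * kron A B * kron (1\<^sub>m a) (ket \<psi>) = vinner \<psi> (B *\<^sub>v \<psi>) \<cdot>\<^sub>m A"
proof -
  have k: "ket \<psi> \<in> carrier_mat b 1" "bra \<psi> \<in> carrier_mat 1 b" "1\<^sub>m a \<in> carrier_mat a a"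
    using assms(3) by auto
  have "adj (kron (1\<^sub>m a) (ket \<psi>)) * kron A B = kron (1\<^sub>m a * A) (bra \<psi> * B)"
    unfolding kron_adj adj_one bra_eq_adj_ket[symmetric] by (rule kron_mult[OF k(3,2) assms(1,2)])
  also have "\<dots> * kron (1\<^sub>m a) (ket \<psi>) = kron (1\<^sub>m a * A * 1\<^sub>m a) (bra \<psi> * B * ket \<psi>)"
    by (rule kron_mult[OF mult_carrier_mat[OF k(3) assms(1)] mult_carrier_mat[OF k(2) assms(2)] k(3,1)])
  also have "1\<^sub>m a * A * 1\<^sub>m a = A" using assms(1) by simp
  also have "bra \<psi> * B * ket \<psi> = bra \<psi> * ket (B *\<^sub>v \<psi>)"
    unfolding mult_ket[OF assms(2,3), symmetric] by (rule assoc_mult_mat[OF k(2) assms(2) k(1)])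
  also have "kron A (bra \<psi> * ket (B *\<^sub>v \<psi>)) = (bra \<psi> * ket (B *\<^sub>v \<psi>)) $$ (0,0) \<cdot>\<^sub>m A"
    by (rule kron_singleton) (use mult_carrier_mat[OF k(2) ket_carrier] assms in auto)
  also have "(bra \<psi> * ket (B *\<^sub>v \<psi>)) $$ (0,0) = vinner \<psi> (B *\<^sub>v \<psi>)"
    using assms by (subst index_mult_mat_sum[OF k(2), of _ 1]) (auto simp: bra_def ket_def vinner_def)
  finally show ?thesis .
qed

lemma mult_msum_mult:
  assumes "X \<in> carrier_mat a b" "Y \<in> carrier_mat c d" "\<And>t. t \<in> I \<Longrightarrow> f t \<in> carrier_mat b c"
  shows "X * msum b c f I * Y = msum a d (\<lambda>t. X * f t * Y) I"
proof -
  have "X * msum b c f I = msum a c (\<lambda>t. X * f t) I"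
    by (rule mult_msum[OF assms(1,3)])
  then show ?thesis
    using msum_mult[OF assms(2) mult_carrier_mat[OF assms(1,3)]] by simp
qed

text \<open>Collects everything the rest of the argument uses about the POVM: rank-one effects that
  resolve the identity and lie in the span of commuting data strings. The indices in
  \<open>I\<close> are sets of generators of the large basis, so the same string may occur under
  several indices.\<close>

lemma eff_povm_expansion:
  assumes basis: "stabilizer_basis (n + m) \<Phi>" and state: "stabilizer_state m \<psi>"
  obtains v and q :: "nat set \<Rightarrow> complex mat" and \<kappa> I where "finite I"
    and "\<And>b. b < 2^(n+m) \<Longrightarrow> v b \<in> carrier_vec (2^n)"
    and "\<And>b. b < 2^(n+m) \<Longrightarrow> eff_povm n \<psi> (\<Phi> b) = proj (v b)"
    and "msum (2^n) (2^n) (\<lambda>b. proj (v b)) {..<2^(n+m)} = 1\<^sub>m (2^n)"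
    and "\<And>t. t \<in> I \<Longrightarrow> q t \<in> pauli_strings n"
    and "\<And>s t. s \<in> I \<Longrightarrow> t \<in> I \<Longrightarrow> q s * q t = q t * q s"
    and "\<And>b. b < 2^(n+m) \<Longrightarrow> proj (v b) = msum (2^n) (2^n) (\<lambda>t. \<kappa> b t \<cdot>\<^sub>m q t) I"
proof -
  define a :: nat where "a = 2^n"
  define d :: nat where "d = 2^m"
  define D :: nat where "D = 2^(n+m)"
  have D: "D = a * d" by (simp add: D_def a_def d_def power_add)
  have \<psi>: "\<psi> \<in> carrier_vec d" "vinner \<psi> \<psi> = 1"
    using state by (simp_all only: stabilizer_state_def d_def)
  have onb: "orthonormal_basis D \<Phi>" using basis by (simp only: stabilizer_basis_def D_def)
  obtain p \<kappa> where p: "\<And>T. T \<subseteq> {..<n+m} \<Longrightarrow> p T \<in> pauli_strings (n+m)"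
    and pcomm: "\<And>S T. S \<subseteq> {..<n+m} \<Longrightarrow> T \<subseteq> {..<n+m} \<Longrightarrow> p S * p T = p T * p S"
    and exp: "\<And>b. b < D \<Longrightarrow> proj (\<Phi> b) = msum D D (\<lambda>T. \<kappa> b T \<cdot>\<^sub>m p T) (Pow {..<n+m})"
    by (rule stabilizer_basis_expansion[OF basis, folded D_def]) (rule that)
  define V where "V = kron (1\<^sub>m a) (ket \<psi>)"
  have V: "V \<in> carrier_mat D a"
    using kron_carrier[OF one_carrier_mat ket_carrier[OF \<psi>(1)], of a] by (simp add: V_def D)
  note aV = adj_carrier[OF V]
  define v where "v b = adj V *\<^sub>v \<Phi> b" for b
  have vc: "v b \<in> carrier_vec a" if "b < D" for b
    using aV orthonormal_basisD(1)[OF onb that] by (simp add: v_def)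
  have vproj: "proj (v b) = adj V * proj (\<Phi> b) * V" if "b < D" for b
    unfolding v_def by (rule proj_adj_mult_vec[OF V orthonormal_basisD(1)[OF onb that], symmetric])
  have total: "msum a a (\<lambda>b. proj (v b)) {..<D} = 1\<^sub>m a"
  proof -
    have "msum a a (\<lambda>b. proj (v b)) {..<D} = msum a a (\<lambda>b. adj V * proj (\<Phi> b) * V) {..<D}"
      using vproj by (intro msum_cong) auto
    also have "\<dots> = adj V * msum D D (\<lambda>b. proj (\<Phi> b)) {..<D} * V"
      by (rule mult_msum_mult[OF aV V, symmetric]) (use orthonormal_basisD(1)[OF onb] in auto)
    \<comment> \<open>Writing the identity as a Kronecker product lets the compression formula
      apply; its scalar is the squared norm of \<psi>, which is 1.\<close>
    also have "\<dots> = adj V * kron (1\<^sub>m a) (1\<^sub>m d) * V"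
      by (simp only: onb_complete[OF onb] kron_one D[symmetric])
    also have "\<dots> = vinner \<psi> (1\<^sub>m d *\<^sub>v \<psi>) \<cdot>\<^sub>m 1\<^sub>m a"
      unfolding V_def by (rule compress_kron[OF one_carrier_mat one_carrier_mat \<psi>(1)])
    finally show ?thesis using \<psi> by simp
  qed
  have "\<forall>T\<in>Pow {..<n+m}. \<exists>AB. fst AB \<in> pauli_strings n \<and> snd AB \<in> pauli_strings m \<and> p T = kron (fst AB) (snd AB)"
  proof
    fix T assume "T \<in> Pow {..<n+m}"
    then obtain A B where "A \<in> pauli_strings n" "B \<in> pauli_strings m" "p T = kron A B"
      using pauli_string_split[OF p[of T]] by blast
    then show "\<exists>AB. fst AB \<in> pauli_strings n \<and> snd AB \<in> pauli_strings m \<and> p T = kron (fst AB) (snd AB)"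
      by (intro exI[of _ "(A,B)"]) simp
  qed
  from bchoice[OF this] obtain AB where AB: "\<And>T. T \<subseteq> {..<n+m} \<Longrightarrow> fst (AB T) \<in> pauli_strings n \<and>
      snd (AB T) \<in> pauli_strings m \<and> p T = kron (fst (AB T)) (snd (AB T))"
    by blast
  define q where "q T = fst (AB T)" for T
  define r where "r T = snd (AB T)" for T
  have q: "q T \<in> pauli_strings n" and r: "r T \<in> pauli_strings m" and pqr: "p T = kron (q T) (r T)"
    if "T \<subseteq> {..<n+m}" for T
    using AB[OF that] by (auto simp: q_def r_def)
  have qc: "q T \<in> carrier_mat a a" and rc: "r T \<in> carrier_mat d d" and pc: "p T \<in> carrier_mat D D"
    if "T \<subseteq> {..<n+m}" for T
    using pauli_string_carrier[OF q[OF that]] pauli_string_carrier[OF r[OF that]]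
      pauli_string_carrier[OF p[OF that]] by (auto simp: a_def d_def D_def)
  define \<alpha> where "\<alpha> T = vinner \<psi> (r T *\<^sub>v \<psi>)" for T
  \<comment> \<open>Terms with vanishing ancilla expectation drop out under compression. They must
    be removed from the index set, because only the remaining strings are known to commute on the
    data side.\<close>
  define I where "I = {T. T \<subseteq> {..<n+m} \<and> \<alpha> T \<noteq> 0}"
  have I: "I \<subseteq> Pow {..<n+m}" by (auto simp: I_def)
  have comp: "adj V * (c \<cdot>\<^sub>m p T) * V = (c * \<alpha> T) \<cdot>\<^sub>m q T" if T: "T \<subseteq> {..<n+m}" for c T
  proof -
    have "adj V * (c \<cdot>\<^sub>m p T) * V = c \<cdot>\<^sub>m (adj V * p T * V)"
      unfolding mult_smult_distrib[OF aV pc[OF T]]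
      by (rule mult_smult_assoc_mat[OF mult_carrier_mat[OF aV pc[OF T]] V])
    also have "adj V * p T * V = \<alpha> T \<cdot>\<^sub>m q T"
      unfolding pqr[OF T] V_def \<alpha>_def by (rule compress_kron[OF qc[OF T] rc[OF T] \<psi>(1)])
    finally show ?thesis by simp
  qed
  show ?thesis
  proof (rule that[of I v q "\<lambda>b T. \<kappa> b T * \<alpha> T", folded a_def, folded D_def])
    show "finite I" using I finite_subset by blast
    fix b assume b: "b < D"
    show "v b \<in> carrier_vec a" by (rule vc[OF b])
    show "eff_povm n \<psi> (\<Phi> b) = proj (v b)"
      unfolding vproj[OF b] by (simp add: eff_povm_def V_def a_def)
    have "proj (v b) = msum a a (\<lambda>T. adj V * (\<kappa> b T \<cdot>\<^sub>m p T) * V) (Pow {..<n+m})"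
      unfolding vproj[OF b] exp[OF b] by (rule mult_msum_mult[OF aV V]) (use pc in auto)
    also have "\<dots> = msum a a (\<lambda>T. (\<kappa> b T * \<alpha> T) \<cdot>\<^sub>m q T) (Pow {..<n+m})"
      using comp by (intro msum_cong) auto
    also have "\<dots> = msum a a (\<lambda>T. (\<kappa> b T * \<alpha> T) \<cdot>\<^sub>m q T) I"
    proof (rule msum_mono_neutral[OF _ I])
      fix t assume "t \<in> Pow {..<n+m} - I"
      then have "\<alpha> t = 0" "q t \<in> carrier_mat a a" using qc by (auto simp: I_def)
      then show "(\<kappa> b t * \<alpha> t) \<cdot>\<^sub>m q t = 0\<^sub>m a a" by (intro eq_matI) auto
    qed simp
    finally show "proj (v b) = msum a a (\<lambda>T. (\<kappa> b T * \<alpha> T) \<cdot>\<^sub>m q T) I" .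
  next
    show "msum a a (\<lambda>b. proj (v b)) {..<D} = 1\<^sub>m a" by (rule total)
  next
    fix T assume "T \<in> I"
    then show "q T \<in> pauli_strings n" using q by (auto simp: I_def)
  next
    fix S T assume ST: "S \<in> I" "T \<in> I"
    then have sub: "S \<subseteq> {..<n+m}" "T \<subseteq> {..<n+m}" and nz: "\<alpha> S \<noteq> 0" "\<alpha> T \<noteq> 0" by (auto simp: I_def)
    have "r S * r T = r T * r S"
      by (rule stabilizer_state_pauli_commute[OF state r[OF sub(1)] r[OF sub(2)] nz[unfolded \<alpha>_def]])
    then show "q S * q T = q T * q S"
      using kron_pauli_commute_left[OF q[OF sub(1)] q[OF sub(2)] r[OF sub(1)] r[OF sub(2)]]
        p[OF sub(1)] p[OF sub(2)] pcomm[OF sub] by (simp only: pqr[OF sub(1)] pqr[OF sub(2)])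
  qed
qed

subsection \<open>Commuting rank-one resolutions of the identity\<close>

lemma smult_zero_left_vec: "v \<in> carrier_vec d \<Longrightarrow> (0::complex) \<cdot>\<^sub>v v = 0\<^sub>v d"
  by (intro eq_vecI) auto

lemma smult_zero_right_vec: "(c::complex) \<cdot>\<^sub>v 0\<^sub>v d = 0\<^sub>v d"
  by (intro eq_vecI) auto

lemma zero_mult_mat_vec: "v \<in> carrier_vec d \<Longrightarrow> 0\<^sub>m d d *\<^sub>v v = (0\<^sub>v d :: complex vec)"
  by (intro eq_vecI) (auto simp: index_mult_mat_vec)

text \<open>Applied to \<open>w\<close>, one order of the product gives a nonzero multiple of
  \<open>v\<close> and the other a multiple of \<open>w\<close>.\<close>

lemma parallel_of_proj_commute:
  assumes v: "v \<in> carrier_vec d" and w: "w \<in> carrier_vec d"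
    and comm: "proj v * proj w = proj w * proj v" and nz: "vinner v w \<noteq> 0"
  shows "\<exists>c. v = c \<cdot>\<^sub>v w"
proof -
  note pv = proj_carrier[OF v] and pw = proj_carrier[OF w]
  have "(proj v * proj w) *\<^sub>v w = vinner w w \<cdot>\<^sub>v (vinner v w \<cdot>\<^sub>v v)"
    by (simp only: assoc_mult_mat_vec[OF pv pw w] proj_mult_vec[OF w w] mult_mat_vec[OF pv w] proj_mult_vec[OF v w])
  moreover have "(proj w * proj v) *\<^sub>v w = vinner v w \<cdot>\<^sub>v (vinner w v \<cdot>\<^sub>v w)"
    by (simp only: assoc_mult_mat_vec[OF pw pv w] proj_mult_vec[OF v w] mult_mat_vec[OF pw v] proj_mult_vec[OF w v])
  ultimately have eq: "vinner w w \<cdot>\<^sub>v (vinner v w \<cdot>\<^sub>v v) = vinner v w \<cdot>\<^sub>v (vinner w v \<cdot>\<^sub>v w)"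
    by (simp only: comm)
  have "vinner w w \<noteq> 0"
  proof
    assume "vinner w w = 0"
    then have "w = 0\<^sub>v d" by (simp only: vinner_self_eq_0[OF w])
    with v nz show False by (simp add: vinner_def)
  qed
  then have "v = (1 / (vinner w w * vinner v w)) \<cdot>\<^sub>v (vinner w w \<cdot>\<^sub>v (vinner v w \<cdot>\<^sub>v v))"
    using nz by (simp add: smult_smult_assoc)
  then have "v = (1 / (vinner w w * vinner v w) * (vinner v w * vinner w v)) \<cdot>\<^sub>v w"
    unfolding eq by (simp add: smult_smult_assoc)
  then show ?thesis by blast
qed

text \<open>Rank-one operators commute only if their ranges are equal or orthogonal, so the distinct ranges of a
  commuting rank-one resolution of the identity form an orthonormal basis.\<close>

lemma commuting_rank_one_resolution:
  fixes M d :: nat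
  assumes d: "0 < d" and v: "\<And>b. b < M \<Longrightarrow> v b \<in> carrier_vec d"
    and comm: "\<And>b b'. b < M \<Longrightarrow> b' < M \<Longrightarrow> proj (v b) * proj (v b') = proj (v b') * proj (v b)"
    and total: "msum d d (\<lambda>b. proj (v b)) {..<M} = 1\<^sub>m d"
  obtains \<Psi> where "orthonormal_basis d \<Psi>"
    and "\<And>c. c < d \<Longrightarrow> \<exists>b<M. \<exists>k. \<Psi> c = k \<cdot>\<^sub>v v b"
    and "\<And>b. b < M \<Longrightarrow> \<exists>c<d. \<exists>k. v b = k \<cdot>\<^sub>v \<Psi> c"
proof -
  \<comment> \<open>Candidates are index sets of nonzero, pairwise orthogonal vectors. A maximal
    candidate holds one representative of every direction.\<close>
  define F where "F = {R. R \<subseteq> {..<M} \<and> (\<forall>r\<in>R. v r \<noteq> 0\<^sub>v d) \<and>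
      (\<forall>r\<in>R. \<forall>s\<in>R. r \<noteq> s \<longrightarrow> vinner (v r) (v s) = 0)}"
  have "finite F" by (rule finite_subset[of _ "Pow {..<M}"]) (auto simp: F_def)
  moreover have "{} \<in> F" by (simp add: F_def)
  ultimately obtain R where R: "R \<in> F" and max: "\<And>R'. R' \<in> F \<Longrightarrow> R \<subseteq> R' \<Longrightarrow> R = R'"
    using finite_has_maximal[of F] by blast
  have RM: "r < M" and Rnz: "v r \<noteq> 0\<^sub>v d" if "r \<in> R" for r
    using R that by (auto simp: F_def)
  have Rorth: "vinner (v r) (v s) = 0" if "r \<in> R" "s \<in> R" "r \<noteq> s" for r s
    using R that by (simp add: F_def)
  have finR: "finite R" using R finite_subset by (auto simp: F_def)
  have cover: "\<exists>r\<in>R. \<exists>c. v b = c \<cdot>\<^sub>v v r" if b: "b < M" "v b \<noteq> 0\<^sub>v d" for b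
  proof (cases "b \<in> R")
    case True
    then show ?thesis by (intro bexI[of _ b] exI[of _ 1]) simp_all
  next
    case False
    \<comment> \<open>If \<open>v b\<close> were orthogonal to all representatives, \<open>b\<close>
      could be added to \<open>R\<close>. A nonzero overlap, together with commutation, makes the
      two vectors parallel.\<close>
    have "\<exists>r\<in>R. vinner (v b) (v r) \<noteq> 0"
    proof (rule ccontr)
      assume "\<not> ?thesis"
      then have o: "vinner (v b) (v r) = 0" if "r \<in> R" for r using that by blast
      have o': "vinner (v r) (v b) = 0" if "r \<in> R" for r
        using vinner_cnj[OF v[OF b(1)] v[OF RM[OF that]]] o[OF that] by simp
      have "insert b R \<in> F"
        using b RM Rnz Rorth o o' unfolding F_def by auto
      with max[of "insert b R"] False show False by blast
    qed
    then obtain r where r: "r \<in> R" "vinner (v b) (v r) \<noteq> 0" by blast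
    then have "\<exists>c. v b = c \<cdot>\<^sub>v v r"
      by (intro parallel_of_proj_commute[OF v[OF b(1)] v[OF RM[OF r(1)]] comm[OF b(1) RM[OF r(1)]]])
    with r(1) show ?thesis by blast
  qed
  define N where "N r = sqrt (\<Sum>i<d. (cmod (v r $ i))\<^sup>2)" for r
  have NN: "vinner (v r) (v r) = of_real (N r) * of_real (N r)" if "r < M" for r
    unfolding vinner_self[OF v[OF that]] N_def of_real_mult[symmetric]
    by (simp add: sum_nonneg del: of_real_sum)
  have N0: "N r \<noteq> 0" if "r \<in> R" for r
    using NN[OF RM[OF that]] vinner_self_eq_0[OF v[OF RM[OF that]]] Rnz[OF that] by auto
  define u where "u r = complex_of_real (1 / N r) \<cdot>\<^sub>v v r" for r
  have uc: "u r \<in> carrier_vec d" if "r \<in> R" for r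
    using v[OF RM[OF that]] by (simp add: u_def)
  have vu: "v r = complex_of_real (N r) \<cdot>\<^sub>v u r" if "r \<in> R" for r
    using N0[OF that] by (simp add: u_def smult_smult_assoc)
  have uu: "vinner (u r) (u s) = (if r = s then 1 else 0)" if rs: "r \<in> R" "s \<in> R" for r s
  proof -
    note vr = v[OF RM[OF rs(1)]] and vs = v[OF RM[OF rs(2)]]
    have "vinner (u r) (u s) = of_real (1 / N r) * (of_real (1 / N s) * vinner (v r) (v s))"
      using vr vs unfolding u_def by (simp add: vinner_smult_left[of _ d] vinner_smult_right[of _ d])
    then show ?thesis
      using Rorth[OF rs] N0[OF rs(1)] NN[OF RM[OF rs(1)]] by auto
  qed
  have coveru: "\<exists>r\<in>R. \<exists>c. v b = c \<cdot>\<^sub>v u r" if b: "b < M" "v b \<noteq> 0\<^sub>v d" for b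
  proof -
    obtain r c where rc: "r \<in> R" "v b = c \<cdot>\<^sub>v v r" using cover[OF b] by blast
    have "v b = (c * complex_of_real (N r)) \<cdot>\<^sub>v u r"
      by (subst rc(2), subst vu[OF rc(1)]) (simp add: smult_smult_assoc)
    with rc(1) show ?thesis by blast
  qed
  have "\<forall>b\<in>{b. b < M \<and> v b \<noteq> 0\<^sub>v d}. \<exists>rc. fst rc \<in> R \<and> v b = snd rc \<cdot>\<^sub>v u (fst rc)"
    using coveru by fastforce
  from bchoice[OF this] obtain rc where rc: "\<And>b. b < M \<Longrightarrow> v b \<noteq> 0\<^sub>v d \<Longrightarrow> fst (rc b) \<in> R \<and>
      v b = snd (rc b) \<cdot>\<^sub>v u (fst (rc b))"
    by blast
  define x where "x b = vinner (v b) (v b)" for b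
  \<comment> \<open>The resolution of the identity is evaluated at \<open>u r\<close>. Vectors of
    other directions annihilate \<open>u r\<close>, so the squared norms along the direction of
    \<open>r\<close> sum to 1.\<close>
  have row: "(\<Sum>b<M. if v b \<noteq> 0\<^sub>v d \<and> fst (rc b) = r then x b else 0) = 1" if r: "r \<in> R" for r
  proof -
    have act: "proj (v b) *\<^sub>v u r = (if v b \<noteq> 0\<^sub>v d \<and> fst (rc b) = r then x b else 0) \<cdot>\<^sub>v u r" if b: "b < M" for b
    proof (cases "v b = 0\<^sub>v d")
      case True
      have "proj (v b) *\<^sub>v u r = 0\<^sub>v d"
        unfolding proj_mult_vec[OF v[OF b] uc[OF r]] unfolding True by (rule smult_zero_right_vec)
      then show ?thesis using smult_zero_left_vec[OF uc[OF r]] True by simp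
    next
      case False
      define s where "s = fst (rc b)"
      define c where "c = snd (rc b)"
      have s: "s \<in> R" "v b = c \<cdot>\<^sub>v u s" using rc[OF b False] by (auto simp: s_def c_def)
      have "x b = cnj c * (c * vinner (u s) (u s))"
        unfolding x_def s(2) using uc[OF s(1)]
        by (simp only: vinner_smult_left[of _ d] vinner_smult_right[of _ d] smult_carrier_vec mult.left_commute)
      then have xc: "x b = cnj c * c" by (simp add: uu[OF s(1) s(1)])
      have "proj (v b) *\<^sub>v u r = (cnj c * vinner (u s) (u r)) \<cdot>\<^sub>v (c \<cdot>\<^sub>v u s)"
        unfolding proj_mult_vec[OF v[OF b] uc[OF r]] unfolding s(2)
        by (simp only: vinner_smult_left[OF uc[OF s(1)] uc[OF r]])
      also have "\<dots> = (if s = r then x b else 0) \<cdot>\<^sub>v u r"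
      proof (cases "s = r")
        case True
        then show ?thesis by (simp add: uu[OF r r] xc smult_smult_assoc)
      next
        case False
        then show ?thesis
          by (simp add: uu[OF s(1) r] smult_smult_assoc smult_zero_left_vec[OF uc[OF s(1)]]
              smult_zero_left_vec[OF uc[OF r]])
      qed
      finally show ?thesis using False by (simp add: s_def)
    qed
    have "msum d d (\<lambda>b. proj (v b)) {..<M} *\<^sub>v u r
        = (\<Sum>b<M. if v b \<noteq> 0\<^sub>v d \<and> fst (rc b) = r then x b else 0) \<cdot>\<^sub>v u r"
      by (rule msum_mult_vec[OF uc[OF r] _ _ uc[OF r]])
        (simp_all only: lessThan_iff proj_carrier[OF v] act)
    then have "(\<Sum>b<M. if v b \<noteq> 0\<^sub>v d \<and> fst (rc b) = r then x b else 0) \<cdot>\<^sub>v u r = 1 \<cdot>\<^sub>v u r"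
      by (simp only: total one_mult_mat_vec[OF uc[OF r]] one_smult_vec)
    moreover have "vinner (u r) (u r) = 1" using uu[OF r r] by simp
    ultimately show ?thesis by (rule smult_vec_inject[OF uc[OF r], rotated])
  qed
  \<comment> \<open>The trace of the identity is the total of all squared norms. Grouped by
    direction, each group contributes 1, so there are as many directions as dimensions.\<close>
  have "of_nat d = (\<Sum>b<M. x b)"
    using tr_msum[of "{..<M}" "\<lambda>b. proj (v b)" d] v tr_one[of d]
    by (simp add: total x_def tr_proj[OF v])
  also have "\<dots> = (\<Sum>b<M. \<Sum>r\<in>R. if v b \<noteq> 0\<^sub>v d \<and> fst (rc b) = r then x b else 0)"
  proof (rule sum.cong[OF refl])
    fix b assume "b \<in> {..<M}"
    then have b: "b < M" by simp
    show "x b = (\<Sum>r\<in>R. if v b \<noteq> 0\<^sub>v d \<and> fst (rc b) = r then x b else 0)"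
    proof (cases "v b = 0\<^sub>v d")
      case True
      then show ?thesis using vinner_self_eq_0[OF v[OF b]] by (simp add: x_def)
    next
      case False
      then show ?thesis using rc[OF b False] finR by simp
    qed
  qed
  also have "\<dots> = (\<Sum>r\<in>R. \<Sum>b<M. if v b \<noteq> 0\<^sub>v d \<and> fst (rc b) = r then x b else 0)"
    by (rule sum.swap)
  also have "\<dots> = of_nat (card R)" using row by simp
  finally have card: "card {..<d} = card R" by (simp only: of_nat_eq_iff card_lessThan)
  obtain e where e: "bij_betw e {..<d} R"
    using finite_same_card_bij[OF finite_lessThan finR card] by blast
  have eR: "e c \<in> R" if "c < d" for c using e that by (auto simp: bij_betw_def)
  show ?thesis
  proof (rule that[of "\<lambda>c. u (e c)"])
    have inj: "e b = e b' \<longleftrightarrow> b = b'" if "b < d" "b' < d" for b b'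
      using e that by (auto simp: bij_betw_def inj_on_def)
    show "orthonormal_basis d (\<lambda>c. u (e c))"
      unfolding orthonormal_basis_def using uc eR inj by (simp add: uu)
  next
    fix c assume c: "c < d"
    show "\<exists>b<M. \<exists>k. u (e c) = k \<cdot>\<^sub>v v b"
      using RM[OF eR[OF c]] unfolding u_def by blast
  next
    fix b assume b: "b < M"
    show "\<exists>c<d. \<exists>k. v b = k \<cdot>\<^sub>v u (e c)"
    proof (cases "v b = 0\<^sub>v d")
      case True
      \<comment> \<open>A vanishing vector has no direction of its own and is assigned to index 0,
        which exists because \<open>d\<close> is positive.\<close>
      then have "v b = 0 \<cdot>\<^sub>v u (e 0)" by (simp only: smult_zero_left_vec[OF uc[OF eR[OF d]]])
      with d show ?thesis by blast
    next
      case False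
      then obtain r k where "r \<in> R" "v b = k \<cdot>\<^sub>v u r" using coveru[OF b] by blast
      moreover obtain c where "c < d" "e c = r"
        using e \<open>r \<in> R\<close> by (auto simp: bij_betw_def)
      ultimately show ?thesis by blast
    qed
  qed
qed

text \<open>A minimal subfamily separating the basis vectors is independent: if a product of some of its members
  were scalar, the eigenvalues of one factor would be determined by those of the others. It has at
  least \<open>n\<close> members because \<open>2\<^sup>n\<close> vectors are separated by sign patterns.\<close>

lemma stabilizer_basis_of_separating:
  assumes onb: "orthonormal_basis (2^n) \<Psi>" and fin: "finite I"
    and q: "\<And>t. t \<in> I \<Longrightarrow> q t \<in> pauli_strings n"
    and ev: "\<And>t c. t \<in> I \<Longrightarrow> c < 2^n \<Longrightarrow> q t *\<^sub>v \<Psi> c = \<sigma> t c \<cdot>\<^sub>v \<Psi> c"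
    and span: "\<And>c. c < 2^n \<Longrightarrow> proj (\<Psi> c) = msum (2^n) (2^n) (\<lambda>t. \<mu> c t \<cdot>\<^sub>m q t) I"
  shows "stabilizer_basis n \<Psi>"
proof -
  define D :: nat where "D = 2^n"
  note o = orthonormal_basisD[OF onb, folded D_def]
  note ev = ev[folded D_def]
  have qc: "q t \<in> carrier_mat D D" if "t \<in> I" for t
    using pauli_string_carrier[OF q[OF that]] by (simp add: D_def)
  have sign: "\<sigma> t c = 1 \<or> \<sigma> t c = -1" if "t \<in> I" "c < D" for t c
    using pauli_eigenvalue[OF q[OF that(1)] o(1)[OF that(2), unfolded D_def] o(2)[OF that(2)] ev[OF that]] by simp
  define sep where "sep H \<longleftrightarrow> (\<forall>c<D. \<forall>c'<D. (\<forall>t\<in>H. \<sigma> t c = \<sigma> t c') \<longrightarrow> c = c')" for H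
  have sepD: "c = c'" if "sep H" "c < D" "c' < D" "\<And>t. t \<in> H \<Longrightarrow> \<sigma> t c = \<sigma> t c'" for H c c'
    using that unfolding sep_def by blast
  \<comment> \<open>If all strings agreed on \<open>\<Psi> c\<close> and \<open>\<Psi> c'\<close>,
    so would their linear combination \<open>proj (\<Psi> c)\<close>; but it has eigenvalue 1 at the
    former and annihilates the latter.\<close>
  have "sep I"
    unfolding sep_def
  proof (intro allI impI, rule ccontr)
    fix c c' assume c: "c < D" "c' < D" "\<forall>t\<in>I. \<sigma> t c = \<sigma> t c'" "c \<noteq> c'"
    have act: "proj (\<Psi> c) *\<^sub>v \<Psi> b = (\<Sum>t\<in>I. \<mu> c t * \<sigma> t b) \<cdot>\<^sub>v \<Psi> b" if b: "b < D" for b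
      unfolding span[folded D_def, OF c(1)]
      by (rule msum_mult_vec[OF o(1)[OF b] _ _ o(1)[OF b]])
        (simp_all add: qc ev[OF _ b] smult_mult_mat_vec[OF qc o(1)[OF b]] smult_smult_assoc)
    have "(\<Sum>t\<in>I. \<mu> c t * \<sigma> t c) = 1"
      using act[OF c(1)] proj_mult_vec[OF o(1)[OF c(1)] o(1)[OF c(1)]]
      by (intro smult_vec_inject[OF o(1,2)[OF c(1)]]) (simp add: o(2)[OF c(1)])
    then have s: "(\<Sum>t\<in>I. \<mu> c t * \<sigma> t c') = 1" using c(3) by simp
    have "vinner (\<Psi> c') (proj (\<Psi> c) *\<^sub>v \<Psi> c') = 0"
      unfolding proj_mult_vec[OF o(1)[OF c(1)] o(1)[OF c(2)]] vinner_smult_right[OF o(1)[OF c(2)] o(1)[OF c(1)]]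
      by (simp add: o(3)[OF c(1,2,4)])
    then show False
      unfolding act[OF c(2)] s vinner_smult_right[OF o(1)[OF c(2)] o(1)[OF c(2)]] o(2)[OF c(2)] by simp
  qed
  define F where "F = {H. H \<subseteq> I \<and> sep H}"
  have "I \<in> F" using \<open>sep I\<close> by (simp only: F_def mem_Collect_eq order_refl simp_thms)
  then have "F \<noteq> {}" by blast
  moreover have "finite F" by (rule finite_subset[of _ "Pow I"]) (auto simp: F_def fin)
  ultimately obtain H where H: "H \<in> F" and min': "\<forall>H'\<in>F. H' \<subseteq> H \<longrightarrow> H = H'"
    using finite_has_minimal[of F] by blast
  have HI: "H \<subseteq> I" and sepH: "sep H" using H by (simp_all only: F_def mem_Collect_eq)
  have min: "\<not> sep (H - {t})" if "t \<in> H" for t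
  proof
    assume "sep (H - {t})"
    then have "H - {t} \<in> F" using HI unfolding F_def by blast
    with min' have "H = H - {t}" by blast
    with that show False by blast
  qed
  have finH: "finite H" using HI fin finite_subset by blast
  \<comment> \<open>A sign pattern is encoded by the set of members with eigenvalue 1, which
    compares \<open>2^n\<close> with the number of subsets of \<open>H\<close>.\<close>
  have "inj_on (\<lambda>c. {t\<in>H. \<sigma> t c = 1}) {..<D}"
  proof (rule inj_onI)
    fix c c' assume c: "c \<in> {..<D}" "c' \<in> {..<D}" and eq: "{t\<in>H. \<sigma> t c = 1} = {t\<in>H. \<sigma> t c' = 1}"
    show "c = c'"
    proof (rule sepD[OF sepH])
      fix t assume t: "t \<in> H"
      with eq have "\<sigma> t c = 1 \<longleftrightarrow> \<sigma> t c' = 1" by blast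
      then show "\<sigma> t c = \<sigma> t c'" using sign[of t c] sign[of t c'] t HI c by auto
    qed (use c in auto)
  qed
  moreover have "(\<lambda>c. {t\<in>H. \<sigma> t c = 1}) ` {..<D} \<subseteq> Pow H" by auto
  ultimately have "card {..<D} \<le> card (Pow H)" using finH by (intro card_inj_on_le) auto
  then have "(2::nat)^n \<le> 2^card H" by (simp add: card_Pow[OF finH] D_def)
  then have nH: "n \<le> card H" by simp
  obtain e where e: "bij_betw e {0..<card H} H" using ex_bij_betw_nat_finite[OF finH] by blast
  have eH: "e i \<in> H" if "i < n" for i using e that nH by (auto simp: bij_betw_def)
  have einj: "e i = e j \<longleftrightarrow> i = j" if "i < n" "j < n" for i j
    using inj_on_eq_iff[OF bij_betw_imp_inj_on[OF e], of i j] that nH by simp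
  \<comment> \<open>Only the first \<open>n\<close> members of the enumeration of \<open>H\<close>
    become generators. Minimality of all of \<open>H\<close> still supplies each of them with two
    basis vectors that no other member separates.\<close>
  define g where "g i = q (e i)" for i
  have eI: "e i \<in> I" if "i < n" for i using eH[OF that] HI by blast
  have gpg: "g i \<in> pauli_group n" if "i < n" for i
    unfolding g_def by (rule pauli_string_in_group[OF q[OF eI[OF that]]])
  have gc: "g i \<in> carrier_mat D D" if "i < n" for i
    unfolding g_def by (rule qc[OF eI[OF that]])
  have gev: "g i *\<^sub>v \<Psi> b = \<sigma> (e i) b \<cdot>\<^sub>v \<Psi> b" if "i < n" "b < D" for i b
    unfolding g_def by (rule ev[OF eI[OF that(1)] that(2)])
  have gcomm: "g i * g j = g j * g i" if "i < n" "j < n" for i j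
    by (rule commute_of_onb_diag[OF onb[folded D_def] gc[OF that(1)] gc[OF that(2)] gev[OF that(1)] gev[OF that(2)]])
  have indep: "mat_prod_list D (map g (sorted_list_of_set T)) \<noteq> k \<cdot>\<^sub>m 1\<^sub>m D"
    if T: "T \<subseteq> {..<n}" "T \<noteq> {}" for T k
  proof
    assume scalar: "mat_prod_list D (map g (sorted_list_of_set T)) = k \<cdot>\<^sub>m 1\<^sub>m D"
    have finT: "finite T" using T(1) finite_subset by blast
    have prod: "(\<Prod>i\<in>T. \<sigma> (e i) b) = k" if b: "b < D" for b
    proof (rule smult_vec_inject[OF o(1,2)[OF b]])
      have "(\<Prod>i\<in>T. \<sigma> (e i) b) \<cdot>\<^sub>v \<Psi> b = mat_prod_list D (map g (sorted_list_of_set T)) *\<^sub>v \<Psi> b"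
        by (rule mat_prod_set_eigen[OF o(1)[OF b] finT, symmetric]) (use T gc gev[OF _ b] in auto)
      also have "\<dots> = k \<cdot>\<^sub>v \<Psi> b"
        unfolding scalar smult_mult_mat_vec[OF one_carrier_mat o(1)[OF b]] using o(1)[OF b] by simp
      finally show "(\<Prod>i\<in>T. \<sigma> (e i) b) \<cdot>\<^sub>v \<Psi> b = k \<cdot>\<^sub>v \<Psi> b" .
    qed
    obtain j where j: "j \<in> T" using T(2) by blast
    then have jn: "j < n" using T(1) by blast
    \<comment> \<open>Removing \<open>e j\<close> leaves two vectors unseparated. A scalar product
      would have the same eigenvalue \<open>k\<close> at both, and cancelling the common nonzero
      factor \<open>X\<close> would make them agree at \<open>e j\<close> as well.\<close>
    obtain b b' where b: "b < D" "b' < D" "b \<noteq> b'" and agree: "\<And>t. t \<in> H - {e j} \<Longrightarrow> \<sigma> t b = \<sigma> t b'"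
      using min[OF eH[OF jn]] unfolding sep_def by blast
    define X where "X = (\<Prod>i\<in>T - {j}. \<sigma> (e i) b)"
    have X': "X = (\<Prod>i\<in>T - {j}. \<sigma> (e i) b')"
      unfolding X_def
    proof (rule prod.cong[OF refl])
      fix i assume "i \<in> T - {j}"
      then have "i < n" "i \<noteq> j" using T(1) by auto
      then show "\<sigma> (e i) b = \<sigma> (e i) b'" using einj[OF _ jn, of i] eH[of i] by (intro agree) simp
    qed
    have "X \<noteq> 0"
    proof -
      have "\<sigma> (e i) b \<noteq> 0" if "i \<in> T - {j}" for i
        using sign[OF eI b(1), of i] T(1) that by auto
      then show ?thesis using finT by (simp add: X_def)
    qed
    moreover have "\<sigma> (e j) b * X = \<sigma> (e j) b' * X"
      using prod[OF b(1)] prod[OF b(2)] prod.remove[OF finT j, of "\<lambda>i. \<sigma> (e i) b"]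
        prod.remove[OF finT j, of "\<lambda>i. \<sigma> (e i) b'"] by (simp only: X_def[symmetric] X'[symmetric])
    ultimately have "\<sigma> (e j) b = \<sigma> (e j) b'" by simp
    then have "\<sigma> t b = \<sigma> t b'" if "t \<in> H" for t using agree[of t] that by (cases "t = e j") simp_all
    then have "b = b'" by (rule sepD[OF sepH b(1,2)])
    with b(3) show False by simp
  qed
  show ?thesis
    unfolding stabilizer_basis_def D_def[symmetric]
  proof (intro conjI exI[of _ g] allI impI onb[folded D_def])
    fix b i assume "b < D" "i < n"
    then show "\<exists>ev. g i *\<^sub>v \<Psi> b = ev \<cdot>\<^sub>v \<Psi> b" using gev by blast
  qed (simp_all only: gpg gcomm indep not_False_eq_True)
qed

subsection \<open>Linear spans and independence\<close>

text \<open>The scalars are absorbed into the coefficients. As \<open>k\<close> may be 0, vanishing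
  effects need no separate treatment.\<close>

lemma mspan_mono_smult:
  assumes "\<And>A. A \<in> S \<Longrightarrow> \<exists>B\<in>S'. \<exists>k. A = k \<cdot>\<^sub>m B"
  shows "mspan d S \<subseteq> mspan d S'"
proof
  fix X assume "X \<in> mspan d S"
  then obtain cs As where X: "X = lin_comb d cs As" "length cs = length As" "set As \<subseteq> S"
    by (auto simp: mspan_def)
  have "\<forall>A\<in>S. \<exists>Bk. fst Bk \<in> S' \<and> A = snd Bk \<cdot>\<^sub>m fst Bk"
    using assms by fastforce
  from bchoice[OF this] obtain f where f: "\<And>A. A \<in> S \<Longrightarrow> fst (f A) \<in> S' \<and> A = snd (f A) \<cdot>\<^sub>m fst (f A)"
    by blast
  define cs' where "cs' = map2 (\<lambda>c A. c * snd (f A)) cs As"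
  define As' where "As' = map (\<lambda>A. fst (f A)) As"
  have "map2 (\<lambda>c A. c \<cdot>\<^sub>m A) cs As = map2 (\<lambda>c A. c \<cdot>\<^sub>m A) cs' As'"
  proof (rule nth_equalityI)
    fix i assume "i < length (map2 (\<lambda>c A. c \<cdot>\<^sub>m A) cs As)"
    then have i: "i < length As" using X(2) by simp
    then have "As ! i = snd (f (As ! i)) \<cdot>\<^sub>m fst (f (As ! i))" using f X(3) by (meson nth_mem subsetD)
    then have "cs ! i \<cdot>\<^sub>m As ! i = (cs ! i * snd (f (As ! i))) \<cdot>\<^sub>m fst (f (As ! i))"
      using smult_smult_mat[of "cs ! i" "snd (f (As ! i))" "fst (f (As ! i))"] by simp
    then show "map2 (\<lambda>c A. c \<cdot>\<^sub>m A) cs As ! i = map2 (\<lambda>c A. c \<cdot>\<^sub>m A) cs' As' ! i"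
      using i X(2) by (simp add: cs'_def As'_def)
  qed (simp add: cs'_def As'_def X(2))
  then have "X = lin_comb d cs' As'" by (simp only: X(1) lin_comb_def)
  moreover have "length cs' = length As'" by (simp add: cs'_def As'_def X(2))
  moreover have "set As' \<subseteq> S'" using f X(3) by (auto simp: As'_def)
  ultimately show "X \<in> mspan d S'" unfolding mspan_def by blast
qed

lemma lin_comb_eq_msum:
  assumes "length cs = length As" "set As \<subseteq> carrier_mat d d"
  shows "lin_comb d cs As = msum d d (\<lambda>i. cs ! i \<cdot>\<^sub>m As ! i) {..<length As}"
  using assms
proof (induction cs As rule: list_induct2)
  case Nil
  show ?case by (rule eq_matI) (auto simp: lin_comb_def msum_def)
next
  case (Cons c cs A As)
  then have IH: "lin_comb d cs As = msum d d (\<lambda>i. cs ! i \<cdot>\<^sub>m As ! i) {..<length As}"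
    and A: "A \<in> carrier_mat d d" by auto
  have "lin_comb d (c # cs) (A # As) = c \<cdot>\<^sub>m A + lin_comb d cs As"
    by (simp add: lin_comb_def)
  also have "\<dots> = msum d d (\<lambda>i. (c # cs) ! i \<cdot>\<^sub>m (A # As) ! i) {..<length (A # As)}"
    unfolding IH using A
    by (intro eq_matI) (auto simp: msum_def sum.lessThan_Suc_shift simp del: sum.lessThan_Suc)
  finally show ?case .
qed

text \<open>Applying a vanishing combination to \<open>\<Psi> j\<close> isolates the
  \<open>j\<close>-th coefficient.\<close>

lemma lin_indep_projs:
  assumes onb: "orthonormal_basis d \<Psi>"
  shows "lin_indep_list d (map (\<lambda>c. proj (\<Psi> c)) [0..<d])"
  unfolding lin_indep_list_def
proof (intro allI impI, elim conjE)
  fix cs :: "complex list"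
  assume len: "length cs = length (map (\<lambda>c. proj (\<Psi> c)) [0..<d])"
    and zero: "lin_comb d cs (map (\<lambda>c. proj (\<Psi> c)) [0..<d]) = 0\<^sub>m d d"
  note o = orthonormal_basisD[OF onb]
  have "lin_comb d cs (map (\<lambda>c. proj (\<Psi> c)) [0..<d])
      = msum d d (\<lambda>i. cs ! i \<cdot>\<^sub>m map (\<lambda>c. proj (\<Psi> c)) [0..<d] ! i) {..<length (map (\<lambda>c. proj (\<Psi> c)) [0..<d])}"
    by (rule lin_comb_eq_msum[OF len]) (use o(1) in auto)
  also have "\<dots> = msum d d (\<lambda>i. cs ! i \<cdot>\<^sub>m proj (\<Psi> i)) {..<d}"
    unfolding length_map length_upt diff_zero by (rule msum_cong) simp
  finally have z: "msum d d (\<lambda>i. cs ! i \<cdot>\<^sub>m proj (\<Psi> i)) {..<d} = 0\<^sub>m d d" by (simp only: zero)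
  have "cs ! j = 0" if j: "j < d" for j
  proof -
    have "msum d d (\<lambda>i. cs ! i \<cdot>\<^sub>m proj (\<Psi> i)) {..<d} *\<^sub>v \<Psi> j = (\<Sum>i<d. if i = j then cs ! i else 0) \<cdot>\<^sub>v \<Psi> j"
    proof (rule msum_mult_vec[OF o(1)[OF j] _ _ o(1)[OF j]])
      fix i assume "i \<in> {..<d}"
      then have i: "i < d" by simp
      show "cs ! i \<cdot>\<^sub>m proj (\<Psi> i) \<in> carrier_mat d d" using o(1)[OF i] by simp
      show "(cs ! i \<cdot>\<^sub>m proj (\<Psi> i)) *\<^sub>v \<Psi> j = (if i = j then cs ! i else 0) \<cdot>\<^sub>v \<Psi> j"
        unfolding smult_mult_mat_vec[OF proj_carrier[OF o(1)[OF i]] o(1)[OF j]] proj_mult_vec[OF o(1)[OF i] o(1)[OF j]]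
        using o(2)[OF j] o(3)[OF i j]
        by (cases "i = j") (simp_all add: smult_zero_right_vec smult_zero_left_vec[OF o(1)[OF i]] smult_zero_left_vec[OF o(1)[OF j]])
    qed
    then have "cs ! j \<cdot>\<^sub>v \<Psi> j = 0 \<cdot>\<^sub>v \<Psi> j"
      unfolding z zero_mult_mat_vec[OF o(1)[OF j]] using j
      by (simp add: smult_zero_left_vec[OF o(1)[OF j]])
    then show ?thesis by (rule smult_vec_inject[OF o(1,2)[OF j]])
  qed
  then show "set cs \<subseteq> {0}" using len by (auto simp: in_set_conv_nth)
qed

theorem theorem1:
  fixes n m :: nat and \<Phi> :: "nat \<Rightarrow> complex vec" and \<psi> :: "complex vec"
  assumes "stabilizer_basis (n + m) \<Phi>"
    and "stabilizer_state m \<psi>"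
  shows "(\<exists>\<Psi>. stabilizer_basis n \<Psi> \<and>
           mspan (2^n) {eff_povm n \<psi> (\<Phi> b) | b. b < 2^(n+m)}
             = mspan (2^n) {proj (\<Psi> c) | c. c < 2^n})
         \<and> span_dim (2^n) {eff_povm n \<psi> (\<Phi> b) | b. b < 2^(n+m)} (2^n)"
proof -
  define a :: nat where "a = 2^n"
  define D :: nat where "D = 2^(n+m)"
  obtain v and q :: "nat set \<Rightarrow> complex mat" and \<kappa> I where fin: "finite I"
    and v: "\<And>b. b < D \<Longrightarrow> v b \<in> carrier_vec a"
    and eff: "\<And>b. b < D \<Longrightarrow> eff_povm n \<psi> (\<Phi> b) = proj (v b)"
    and total: "msum a a (\<lambda>b. proj (v b)) {..<D} = 1\<^sub>m a"
    and q: "\<And>t. t \<in> I \<Longrightarrow> q t \<in> pauli_strings n"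
    and qcomm: "\<And>s t. s \<in> I \<Longrightarrow> t \<in> I \<Longrightarrow> q s * q t = q t * q s"
    and expand: "\<And>b. b < D \<Longrightarrow> proj (v b) = msum a a (\<lambda>t. \<kappa> b t \<cdot>\<^sub>m q t) I"
    by (rule eff_povm_expansion[OF assms, folded a_def, folded D_def]) (rule that)
  have qc: "q t \<in> carrier_mat a a" if "t \<in> I" for t
    using pauli_string_carrier[OF q[OF that]] by (simp add: a_def)
  \<comment> \<open>Stated for arbitrary \<open>X\<close> because it is used twice: with a string
    for \<open>X\<close>, strings commute with effects; then, with an effect for \<open>X\<close>,
    effects commute with each other.\<close>
  have comm_expand: "X * proj (v b) = proj (v b) * X"
    if X: "X \<in> carrier_mat a a" "\<And>t. t \<in> I \<Longrightarrow> X * q t = q t * X" and b: "b < D" for X b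
    unfolding expand[OF b]
  proof (rule msum_commute[OF X(1)])
    fix t assume t: "t \<in> I"
    show "\<kappa> b t \<cdot>\<^sub>m q t \<in> carrier_mat a a" using qc[OF t] by simp
    show "X * (\<kappa> b t \<cdot>\<^sub>m q t) = (\<kappa> b t \<cdot>\<^sub>m q t) * X"
      by (simp only: mult_smult_distrib[OF X(1) qc[OF t]] mult_smult_assoc_mat[OF qc[OF t] X(1)] X(2)[OF t])
  qed
  have q_proj: "q t * proj (v b) = proj (v b) * q t" if "t \<in> I" "b < D" for t b
    by (rule comm_expand[OF qc[OF that(1)] qcomm[OF that(1)] that(2)])
  have proj_proj: "proj (v b) * proj (v b') = proj (v b') * proj (v b)" if b: "b < D" "b' < D" for b b'
    by (rule comm_expand[OF proj_carrier[OF v[OF b(1)]] q_proj[OF _ b(1), symmetric] b(2)])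
  have "0 < a" by (simp add: a_def)
  then obtain \<Psi> where onb: "orthonormal_basis a \<Psi>"
    and \<Psi>v: "\<And>c. c < a \<Longrightarrow> \<exists>b<D. \<exists>k. \<Psi> c = k \<cdot>\<^sub>v v b"
    and v\<Psi>: "\<And>b. b < D \<Longrightarrow> \<exists>c<a. \<exists>k. v b = k \<cdot>\<^sub>v \<Psi> c"
    by (rule commuting_rank_one_resolution[OF _ v proj_proj total]) (assumption+, rule that)
  note o = orthonormal_basisD[OF onb]
  have proj\<Psi>: "\<exists>b<D. \<exists>k. proj (\<Psi> c) = k \<cdot>\<^sub>m proj (v b)" if c: "c < a" for c
  proof -
    obtain b k where b: "b < D" "\<Psi> c = k \<cdot>\<^sub>v v b" using \<Psi>v[OF c] by blast
    have "proj (\<Psi> c) = (k * cnj k) \<cdot>\<^sub>m proj (v b)" unfolding b(2) by (rule proj_smult)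
    with b(1) show ?thesis by blast
  qed
  \<comment> \<open>Each basis projection is a multiple of some effect, so the strings commute with
    it.\<close>
  have ev: "q t *\<^sub>v \<Psi> c = vinner (\<Psi> c) (q t *\<^sub>v \<Psi> c) \<cdot>\<^sub>v \<Psi> c" if t: "t \<in> I" and c: "c < a" for t c
  proof (rule proj_commute_eigen[OF qc[OF t] o(1,2)[OF c]])
    obtain b k where b: "b < D" "proj (\<Psi> c) = k \<cdot>\<^sub>m proj (v b)" using proj\<Psi>[OF c] by blast
    note p = proj_carrier[OF v[OF b(1)]]
    show "q t * proj (\<Psi> c) = proj (\<Psi> c) * q t"
      by (simp only: b(2) mult_smult_distrib[OF qc[OF t] p] mult_smult_assoc_mat[OF p qc[OF t]] q_proj[OF t b(1)])
  qed
  \<comment> \<open>The expansion of an effect is rescaled to one of a basis projection; this is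
    what makes the surviving strings separate the basis vectors.\<close>
  have "\<forall>c\<in>{..<a}. \<exists>\<mu>. proj (\<Psi> c) = msum a a (\<lambda>t. \<mu> t \<cdot>\<^sub>m q t) I"
  proof
    fix c assume "c \<in> {..<a}"
    then obtain b k where b: "b < D" "proj (\<Psi> c) = k \<cdot>\<^sub>m proj (v b)" using proj\<Psi>[of c] by auto
    have "proj (\<Psi> c) = msum a a (\<lambda>t. k \<cdot>\<^sub>m (\<kappa> b t \<cdot>\<^sub>m q t)) I"
      unfolding b(2) expand[OF b(1)] using qc by (intro smult_msum) auto
    then have "proj (\<Psi> c) = msum a a (\<lambda>t. (k * \<kappa> b t) \<cdot>\<^sub>m q t) I"
      by (simp only: smult_smult_mat)
    then show "\<exists>\<mu>. proj (\<Psi> c) = msum a a (\<lambda>t. \<mu> t \<cdot>\<^sub>m q t) I"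
      by (rule exI[of _ "\<lambda>t. k * \<kappa> b t"])
  qed
  from bchoice[OF this] obtain \<mu> where \<mu>: "\<And>c. c < a \<Longrightarrow> proj (\<Psi> c) = msum a a (\<lambda>t. \<mu> c t \<cdot>\<^sub>m q t) I"
    by (auto simp only: lessThan_iff)
  have basis: "stabilizer_basis n \<Psi>"
    by (rule stabilizer_basis_of_separating[OF onb[unfolded a_def] fin q])
      (use ev \<mu> in \<open>simp_all only: a_def\<close>)
  have span: "mspan a {eff_povm n \<psi> (\<Phi> b) | b. b < D} = mspan a {proj (\<Psi> c) | c. c < a}"
  proof (intro equalityI mspan_mono_smult)
    fix A assume "A \<in> {eff_povm n \<psi> (\<Phi> b) | b. b < D}"
    then obtain b where b: "b < D" "A = proj (v b)" using eff by blast
    obtain c k where c: "c < a" "v b = k \<cdot>\<^sub>v \<Psi> c" using v\<Psi>[OF b(1)] by blast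
    have "A = (k * cnj k) \<cdot>\<^sub>m proj (\<Psi> c)" unfolding b(2) c(2) by (rule proj_smult)
    with c(1) show "\<exists>B\<in>{proj (\<Psi> c) | c. c < a}. \<exists>k. A = k \<cdot>\<^sub>m B" by blast
  next
    fix A assume "A \<in> {proj (\<Psi> c) | c. c < a}"
    then obtain c where c: "c < a" "A = proj (\<Psi> c)" by blast
    then obtain b k where b: "b < D" "A = k \<cdot>\<^sub>m proj (v b)" using proj\<Psi>[OF c(1)] by blast
    then show "\<exists>B\<in>{eff_povm n \<psi> (\<Phi> b) | b. b < D}. \<exists>k. A = k \<cdot>\<^sub>m B"
      unfolding eff[OF b(1), symmetric] by blast
  qed
  have "set (map (\<lambda>c. proj (\<Psi> c)) [0..<a]) = {proj (\<Psi> c) | c. c < a}" by auto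
  then have "span_dim a {eff_povm n \<psi> (\<Phi> b) | b. b < D} a"
    unfolding span_dim_def using lin_indep_projs[OF onb] span o(1)
    by (intro exI[of _ "map (\<lambda>c. proj (\<Psi> c)) [0..<a]"]) auto
  with basis span show ?thesis unfolding a_def D_def by blast
qed

end
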